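(* For every spherical curve $P$ (with at least one crossing), $r(P)\le 4$. That is, applying at most four successive inverse-half-twisted splices to $P$ always produces a reducible spherical curve.
   Context: A spherical curve is a smooth immersion $P:S^1\to S^2$ whose self-intersections are finitely many transverse double points, called crossings. The curve is oriented and has at least one crossing. The Gauss word of $P$ is the cyclic word obtained by recording the crossings in the order they are passed when traversing the curve once; each crossing appears exactly twice. Equivalently, the chord diagram of $P$ is the oriented circle $S^1$ with a chord joining the two preimages of each crossing. Two crossings $a,b$ are interlaced if their occurrences alternate $a\dots b\dots a\dots b$ in the cyclic Gauss word, i.e., their chords cross. A crossing $p$ is reducible if no crossing is interlaced with $p$; geometrically, this means only three distinct regions of $S^2\setminus P(S^1)$ meet at $p$ instead of four. $P$ is reducible if it has a reducible crossing, and reduced otherwise. The inverse-half-twisted splice $I$ at a crossing $p$ is defined as follows: if the cyclic Gauss word is $p\,A\,p\,B$, replace a small neighbourhood of $p$ by the smoothing of $p$ that yields a single closed curve (the smoothing not respecting the orientation). The result is a spherical curve with one crossing fewer whose Gauss word is $\overline{A}\,B$, where $\overline{A}$ is $A$ read backwards; it is then re-oriented arbitrarily. The reductivity $r(P)$ is the minimal number of successive applications of $I$ needed to obtain a reducible spherical curve from $P$; in particular $r(P)=0$ if and only if $P$ is reducible. *)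

theory Defs
  imports "HOL-Analysis.Analysis"
begin

definition iter_vderiv :: "nat \<Rightarrow> (real \<Rightarrow> real^3) \<Rightarrow> real \<Rightarrow> real^3" where
  "iter_vderiv n g = ((\<lambda>f t. vector_derivative f (at t)) ^^ n) g"

definition smooth_curve :: "(real \<Rightarrow> real^3) \<Rightarrow> bool" where
  "smooth_curve g \<longleftrightarrow> (\<forall>n t. iter_vderiv n g differentiable (at t))"

definition double_params :: "(real \<Rightarrow> real^3) \<Rightarrow> real set" where
  "double_params g = {t \<in> {0..<1}. \<exists>s \<in> {0..<1}. s \<noteq> t \<and> g s = g t}"

definition spherical_curve :: "(real \<Rightarrow> real^3) \<Rightarrow> bool" where
  "spherical_curve g \<longleftrightarrow>
     (\<forall>t. g (t + 1) = g t) \<and>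
     (\<forall>t. g t \<in> sphere 0 1) \<and>
     smooth_curve g \<and>
     (\<forall>t. vector_derivative g (at t) \<noteq> 0) \<and>
     finite (double_params g) \<and>
     double_params g \<noteq> {} \<and>
     (\<forall>t\<in>{0..<1}. \<forall>s\<in>{0..<1}. \<forall>u\<in>{0..<1}.
        t \<noteq> s \<and> s \<noteq> u \<and> t \<noteq> u \<longrightarrow> \<not> (g t = g s \<and> g s = g u)) \<and>
     (\<forall>t\<in>{0..<1}. \<forall>s\<in>{0..<1}. t \<noteq> s \<and> g t = g s \<longrightarrow>
        \<not> (\<exists>c. vector_derivative g (at s) = c *\<^sub>R vector_derivative g (at t)))"

text \<open>Gauss word (as a linear representative of the cyclic word, read from parameter 0):
  crossings are labelled by their image points.\<close>
definition gauss_word :: "(real \<Rightarrow> real^3) \<Rightarrow> (real^3) list" where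
  "gauss_word g = map g (sorted_list_of_set (double_params g))"

definition interlaced :: "'a list \<Rightarrow> 'a \<Rightarrow> 'a \<Rightarrow> bool" where
  "interlaced w a b \<longleftrightarrow> a \<noteq> b \<and>
     (\<exists>i j. i < j \<and> j < length w \<and> w ! i = a \<and> w ! j = a \<and>
        card {k. i < k \<and> k < j \<and> w ! k = b} = 1)"

definition reducible_word :: "'a list \<Rightarrow> bool" where
  "reducible_word w \<longleftrightarrow> (\<exists>p \<in> set w. \<forall>q \<in> set w. \<not> interlaced w p q)"

text \<open>Inverse-half-twisted splice: cyclic word p A p B becomes (rev A) B, re-oriented arbitrarily.\<close>
definition splice_step :: "'a list \<Rightarrow> 'a list \<Rightarrow> bool" where
  "splice_step w v \<longleftrightarrow> (\<exists>k p A B. rotate k w = p # A @ p # B \<and> p \<notin> set A \<and> p \<notin> set B \<and>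
      (v = rev A @ B \<or> v = rev (rev A @ B)))"

end

theory Submission
  imports Defs "HOL-Complex_Analysis.Winding_Numbers"
begin

text \<open>
  On the interlacement graph of a double occurrence word, a splice at \<open>p\<close> is local complementation
  at \<open>p\<close> followed by deletion of \<open>p\<close>.  If the curve has a complementary region with at most three
  sides, every crossing that is not a corner of the region is interlaced with an even number of its
  corners, and a short case analysis on the graph induced by the corners isolates a crossing after at
  most four splices.

  A region with at most three sides exists by counting.  After stereographic projection, the winding
  number parity of the loop based at a crossing \<open>p\<close> colours the regions, and the colour changes exactly
  across the edges of that loop.  With \<open>n\<close> crossings, sums of these colourings and constants give
  \<open>2 ^ (n + 1)\<close> distinct functions on regions, so there are at least \<open>n + 1\<close> regions, while their numbers
  of sides add up to \<open>4 * n\<close>.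
\<close>

section \<open>Double occurrence words and splices\<close>

text \<open>Not every double occurrence word comes from a curve on the sphere, so topology must
  enter; it does so through winding numbers. Regions are never formed as sets. A side of a region is
  a dart (an edge with a direction), the boundary walk that turns left permutes the darts, and what
  is used of a region is that colours are constant along this walk. Accordingly the count concerns
  fibres of the vector of all colours, each a union of orbits of the walk. The number 4 is the worst
  case of a chain. For three pairwise non-interlaced corners, one splice makes two of them
  interlaced, a second turns two corners into twins (interlaced with the same other crossings), a
  third makes the twins interlaced, a fourth isolates one of them. The local geometry of the curve
  is reduced to cones: near a parameter the curve stays in a narrow cone around its tangent, so
  points on one side of it, or in one corner of a crossing, are joined by explicit segments that
  avoid the curve.\<close>

definition double_word :: "'a list \<Rightarrow> bool" where
  "double_word w \<longleftrightarrow> (\<forall>x\<in>set w. count_list w x = 2)"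

lemma count_list_two_split:
  assumes "count_list w x = 2"
  obtains A B C where "w = A @ x # B @ x # C" "x \<notin> set A" "x \<notin> set B" "x \<notin> set C"
proof -
  have "x \<in> set w" using assms by (metis count_list_0_iff zero_neq_numeral)
  then obtain A D where D: "w = A @ x # D" "x \<notin> set A" by (meson split_list_first)
  then have cD: "count_list D x = 1" using assms by (simp add: count_list_0_iff)
  then have "x \<in> set D" by (metis count_list_0_iff zero_neq_one)
  then obtain B C where "D = B @ x # C" "x \<notin> set B" by (meson split_list_first)
  moreover from this have "x \<notin> set C" using cD by (simp add: count_list_0_iff)
  ultimately show ?thesis using D that by blast
qed

text \<open>Same relation as \<open>interlaced\<close>, but where that one counts between two
  positions of a linear word, this one deletes all other letters. Invariance under rotation becomes
  visible, and \<open>splice_step\<close> begins with a rotation.\<close>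

definition alternating :: "'a list \<Rightarrow> 'a \<Rightarrow> 'a \<Rightarrow> bool" where
  "alternating w a b \<longleftrightarrow> a \<noteq> b \<and>
     filter (\<lambda>x. x = a \<or> x = b) w \<in> {[a, b, a, b], [b, a, b, a]}"

lemma alternating_commute: "alternating w a b = alternating w b a"
proof -
  have "(\<lambda>x. x = a \<or> x = b) = (\<lambda>x. x = b \<or> x = a)" by auto
  then show ?thesis unfolding alternating_def by auto
qed

lemma alternating_rotate1: "alternating (rotate1 w) a b = alternating w a b"
proof (cases w)
  case (Cons x u)
  consider "x = a" | "x = b" "x \<noteq> a" | "x \<noteq> a" "x \<noteq> b" by blast
  then show ?thesis
    unfolding alternating_def Cons by cases (auto simp: snoc_eq_iff_butlast butlast_append)
qed simp

lemma alternating_rotate: "alternating (rotate k w) a b = alternating w a b"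
  by (induction k) (simp_all add: alternating_rotate1)

lemma card_positions: "card {k. k < length w \<and> w ! k = x} = count_list w x"
proof -
  have "(\<lambda>y. x = y) = (\<lambda>y. y = x)" by auto
  then show ?thesis by (simp add: count_list_eq_length_filter length_filter_conv_card)
qed

text \<open>The pair of positions of \<open>a\<close> is unique in a double occurrence word, so the
  existential in \<open>interlaced\<close> may be evaluated at any known pair.\<close>

lemma interlaced_iff_card:
  assumes w: "double_word w" and ij: "i < j" "j < length w" "w ! i = a" "w ! j = a" and "a \<noteq> b"
  shows "interlaced w a b \<longleftrightarrow> card {k. i < k \<and> k < j \<and> w ! k = b} = 1"
proof
  assume "interlaced w a b"
  then obtain i' j' where *: "i' < j'" "j' < length w" "w ! i' = a" "w ! j' = a"
    "card {k. i' < k \<and> k < j' \<and> w ! k = b} = 1" unfolding interlaced_def by blast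
  let ?S = "{k. k < length w \<and> w ! k = a}"
  have "a \<in> set w" using ij by (metis nth_mem)
  then have "card ?S = 2" using w unfolding double_word_def card_positions by blast
  moreover have "{i, j} \<subseteq> ?S" "{i', j'} \<subseteq> ?S" using ij * by auto
  moreover have "card {i, j} = 2" "card {i', j'} = 2" using ij * by auto
  moreover have "finite ?S" by simp
  ultimately have "{i, j} = {i', j'}" by (metis card_subset_eq)
  then have "i' = i" "j' = j" using ij * by (metis doubleton_eq_iff less_asym)+
  then show "card {k. i < k \<and> k < j \<and> w ! k = b} = 1" using * by simp
next
  assume "card {k. i < k \<and> k < j \<and> w ! k = b} = 1"
  then show "interlaced w a b" unfolding interlaced_def using ij \<open>a \<noteq> b\<close> by blast
qed

lemma filter_replicate_count:
  "a \<notin> set A \<Longrightarrow> filter (\<lambda>x. x = a \<or> x = b) A = replicate (count_list A b) b"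
  by (induction A) auto

lemma interlaced_iff_alternating:
  assumes w: "double_word w" and a: "a \<in> set w" and b: "b \<in> set w"
  shows "interlaced w a b \<longleftrightarrow> alternating w a b"
proof (cases "a = b")
  case True
  then show ?thesis by (simp add: interlaced_def alternating_def)
next
  case False
  have "count_list w a = 2" using w a by (auto simp: double_word_def)
  then obtain A B C where s: "w = A @ a # B @ a # C" "a \<notin> set A" "a \<notin> set B" "a \<notin> set C"
    by (rule count_list_two_split)
  let ?i = "length A" and ?j = "length A + Suc (length B)"
  have "{k. ?i < k \<and> k < ?j \<and> w ! k = b} = (\<lambda>m. Suc (?i + m)) ` {m. m < length B \<and> B ! m = b}"
  proof (intro set_eqI iffI)
    fix k assume "k \<in> {k. ?i < k \<and> k < ?j \<and> w ! k = b}"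
    then have k: "?i < k" "k < ?j" "w ! k = b" by auto
    then obtain m where m: "k = Suc (?i + m)" "m < length B" using less_imp_Suc_add[OF k(1)] by auto
    then have "w ! k = B ! m" by (simp add: s(1) nth_append)
    then show "k \<in> (\<lambda>m. Suc (?i + m)) ` {m. m < length B \<and> B ! m = b}"
      using m k by (intro image_eqI[of _ _ m]) auto
  qed (auto simp: s nth_append)
  then have "card {k. ?i < k \<and> k < ?j \<and> w ! k = b} = card {m. m < length B \<and> B ! m = b}"
    by (simp add: card_image inj_on_def)
  then have c: "card {k. ?i < k \<and> k < ?j \<and> w ! k = b} = count_list B b" 
    by (simp add: card_positions)
  have i: "interlaced w a b \<longleftrightarrow> count_list B b = 1"
    using interlaced_iff_card[of w ?i ?j a b, OF w _ _ _ _ False] c by (simp add: s nth_append)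
  have "count_list w b = 2" using w b by (auto simp: double_word_def)
  then have "count_list A b + count_list B b + count_list C b = 2" using False by (simp add: s)
  \<comment> \<open>Six ways to distribute the two copies of \<open>b\<close> over the gaps
    \<open>A\<close>, \<open>B\<close>, \<open>C\<close> left by the copies of \<open>a\<close>;
    those with exactly one copy in \<open>B\<close> alternate.\<close>
  moreover have "(x = 2 \<and> y = 0 \<and> z = 0) \<or> (x = 0 \<and> y = 2 \<and> z = 0) \<or> (x = 0 \<and> y = 0 \<and> z = 2) \<or>
      (x = 1 \<and> y = 1 \<and> z = 0) \<or> (x = 1 \<and> y = 0 \<and> z = 1) \<or> (x = 0 \<and> y = 1 \<and> z = 1)"
    if "x + y + z = 2" for x y z :: nat using that by (cases x; cases y; cases z; auto)
  ultimately have "(count_list A b = 2 \<and> count_list B b = 0 \<and> count_list C b = 0) \<or>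
    (count_list A b = 0 \<and> count_list B b = 2 \<and> count_list C b = 0) \<or>
    (count_list A b = 0 \<and> count_list B b = 0 \<and> count_list C b = 2) \<or>
    (count_list A b = 1 \<and> count_list B b = 1 \<and> count_list C b = 0) \<or>
    (count_list A b = 1 \<and> count_list B b = 0 \<and> count_list C b = 1) \<or>
    (count_list A b = 0 \<and> count_list B b = 1 \<and> count_list C b = 1)" by simp
  then show ?thesis unfolding i unfolding alternating_def s(1)
    using False by (elim disjE conjE) (simp_all add: filter_replicate_count s(2-4) numeral_2_eq_2)
qed

lemma interlaced_commute:
  assumes "double_word w" "a \<in> set w" "b \<in> set w"
  shows "interlaced w a b = interlaced w b a"
  using assms by (simp add: interlaced_iff_alternating alternating_commute)

lemma interlaced_iff_separated:
  assumes w: "double_word w" and "x1 < x2" "x2 < length w" "w ! x1 = x" "w ! x2 = x"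
    and "i < length w" "j < length w" "i \<noteq> j" "w ! i = a" "w ! j = a" and "a \<noteq> x"
  shows "interlaced w x a \<longleftrightarrow> (x1 < i \<and> i < x2) \<noteq> (x1 < j \<and> j < x2)"
proof -
  let ?S = "{k. k < length w \<and> w ! k = a}"
  have "a \<in> set w" using assms by (metis nth_mem)
  then have "card ?S = 2" using w unfolding double_word_def card_positions by blast
  moreover have "{i, j} \<subseteq> ?S" "card {i, j} = 2" "finite ?S" using assms by auto
  ultimately have S: "?S = {i, j}" by (metis card_subset_eq)
  have "{k. x1 < k \<and> k < x2 \<and> w ! k = a} = {k. k \<in> ?S \<and> x1 < k \<and> k < x2}" using assms by auto
  also have "\<dots> = (if x1 < i \<and> i < x2 then {i} else {}) \<union> (if x1 < j \<and> j < x2 then {j} else {})"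
    unfolding S by auto
  finally have "card {k. x1 < k \<and> k < x2 \<and> w ! k = a} =
    of_bool (x1 < i \<and> i < x2) + of_bool (x1 < j \<and> j < x2)" using \<open>i \<noteq> j\<close> by (auto simp: card_insert_if)
  then show ?thesis using interlaced_iff_card[of w x1 x2 x a] assms by auto
qed

text \<open>One distribution matters: if \<open>u\<close> holds one copy of each letter, reversal
  exchanges \<open>ab\<close> and \<open>ba\<close> in front of an unchanged \<open>v\<close>. For
  every other distribution reversal leaves alternation as it was. Four letters in all leave finitely
  many cut points to check.\<close>

lemma set_two_letters_cases:
  assumes "count_list u a + count_list v a = 2" "count_list u b + count_list v b = 2"
    "set u \<subseteq> {a, b}" "set v \<subseteq> {a, b}" "a \<noteq> b"
  shows "(rev u @ v \<in> {[a, b, a, b], [b, a, b, a]}) =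
    ((u @ v \<in> {[a, b, a, b], [b, a, b, a]}) \<noteq> (count_list u a = 1 \<and> count_list u b = 1))"
proof -
  have len: "length x = count_list x a + count_list x b" if "set x \<subseteq> {a, b}" for x
    using that \<open>a \<noteq> b\<close> by (induction x) auto
  have "length u + length v = 4" using len[OF assms(3)] len[OF assms(4)] assms(1,2) by simp
  then have "length (u @ v) = Suc (Suc (Suc (Suc 0)))" by simp
  then obtain x y z t where uv: "u @ v = [x, y, z, t]" by (auto simp: length_Suc_conv simp del: length_append)
  have "set (u @ v) \<subseteq> {a, b}" using assms(3,4) by simp
  then have "x \<in> {a, b}" "y \<in> {a, b}" "z \<in> {a, b}" "t \<in> {a, b}" unfolding uv by auto
  moreover have "(u = [] \<and> v = [x, y, z, t]) \<or> (u = [x] \<and> v = [y, z, t]) \<or> (u = [x, y] \<and> v = [z, t]) \<or>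
      (u = [x, y, z] \<and> v = [t]) \<or> (u = [x, y, z, t] \<and> v = [])"
    using uv by (simp add: append_eq_Cons_conv) blast
  ultimately show ?thesis using assms(1,2,5)
    by (elim disjE insertE emptyE conjE; simp)
qed

text \<open>On the interlacement graph a splice is local complementation at \<open>p\<close> followed by the
  deletion of \<open>p\<close>.\<close>
lemma splice_local_complement:
  assumes w: "double_word w" and p: "p \<in> set w"
  obtains v where "splice_step w v" "double_word v" "set v = set w - {p}"
    "\<And>a b. a \<in> set v \<Longrightarrow> b \<in> set v \<Longrightarrow> a \<noteq> b \<Longrightarrow>
      interlaced v a b \<longleftrightarrow> (interlaced w a b \<noteq> (interlaced w p a \<and> interlaced w p b))"
proof -
  have "count_list w p = 2" using w p by (auto simp: double_word_def)
  then obtain A0 A B0 where s: "w = A0 @ p # A @ p # B0" "p \<notin> set A0" "p \<notin> set A" "p \<notin> set B0"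
    by (rule count_list_two_split)
  \<comment> \<open>Cyclically the letters after the second \<open>p\<close> continue with those
    before the first.\<close>
  define B where "B = B0 @ A0"
  define v where "v = rev A @ B"
  define u where "u = p # A @ p # B"
  have r: "rotate (length A0) w = u"
    unfolding s(1) rotate_append u_def B_def by simp
  have pB: "p \<notin> set B" using s by (simp add: B_def)
  have st: "splice_step w v" 
    unfolding splice_step_def using r s pB by (intro exI[of _ "length A0"] exI) (auto simp: u_def v_def)
  have cu: "count_list u x = count_list w x" for x by (simp add: u_def s(1) B_def)
  have cv: "count_list v x = count_list w x" if "x \<noteq> p" for x
    using that by (simp add: v_def s(1) B_def)
  have sv: "set v = set w - {p}" using s by (auto simp: v_def B_def)
  have dv: "double_word v" using w cv sv by (auto simp: double_word_def)
  have su: "set u = set w" by (metis r set_rotate)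
  have du: "double_word u" using w by (auto simp: double_word_def cu su)
  have adj: "interlaced w a b = interlaced u a b" if "a \<in> set w" "b \<in> set w" for a b
    using that w du by (simp add: interlaced_iff_alternating su flip: r) (simp add: alternating_rotate)
  \<comment> \<open>Translates the toggling condition of the two-letter lemma, one copy inside
    \<open>A\<close>, into interlacement with \<open>p\<close>.\<close>
  have ip: "interlaced u p x \<longleftrightarrow> count_list A x = 1" if "x \<in> set v" for x
  proof -
    have x: "x \<in> set u" "x \<noteq> p" using that sv su by auto
    have "count_list u x = 2" using du x by (auto simp: double_word_def)
    then have "count_list A x + count_list B x = 2" using x by (simp add: u_def)
    then consider "count_list A x = 2" "count_list B x = 0" | "count_list A x = 1" "count_list B x = 1" 
      | "count_list A x = 0" "count_list B x = 2" by linarith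
    then show ?thesis using x s du p
      by cases (simp_all add: interlaced_iff_alternating su alternating_def u_def filter_replicate_count
          pB numeral_2_eq_2)
  qed
  have "interlaced v a b \<longleftrightarrow> (interlaced w a b \<noteq> (interlaced w p a \<and> interlaced w p b))"
    if ab: "a \<in> set v" "b \<in> set v" "a \<noteq> b" for a b
  proof -
    let ?f = "filter (\<lambda>x. x = a \<or> x = b)"
    have "a \<noteq> p" "b \<noteq> p" using ab sv by auto
    have ct: "count_list (?f l) a = count_list l a" "count_list (?f l) b = count_list l b" for l
      by (induction l) auto
    have "count_list v a = 2" "count_list v b = 2" using dv ab by (auto simp: double_word_def)
    then have "count_list (?f A) a + count_list (?f B) a = 2" "count_list (?f A) b + count_list (?f B) b = 2"
      by (simp_all add: ct v_def)
    from set_two_letters_cases[OF this] \<open>a \<noteq> b\<close>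
    have "(?f v \<in> {[a, b, a, b], [b, a, b, a]}) =
      ((?f u \<in> {[a, b, a, b], [b, a, b, a]}) \<noteq> (count_list A a = 1 \<and> count_list A b = 1))"
      using \<open>a \<noteq> p\<close> \<open>b \<noteq> p\<close> by (auto simp: ct v_def u_def rev_filter)
    moreover have "a \<in> set w" "b \<in> set w" using ab sv by auto
    ultimately show ?thesis
      using ab dv du by (simp add: adj p ip) (simp add: interlaced_iff_alternating su alternating_def)
  qed
  then show ?thesis by (rule that[OF st dv sv])
qed


section \<open>Splice counts for twins and triangles in the interlacement graph\<close>

definition reduces_within :: "nat \<Rightarrow> 'a list \<Rightarrow> bool" where
  "reduces_within m w \<longleftrightarrow> (\<exists>k\<le>m. \<exists>v. (splice_step ^^ k) w v \<and> reducible_word v)"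

lemma reduces_within_mono: "reduces_within m w \<Longrightarrow> m \<le> n \<Longrightarrow> reduces_within n w"
  unfolding reduces_within_def using le_trans by blast

lemma reduces_within_splice:
  assumes "splice_step w v" "reduces_within m v"
  shows "reduces_within (Suc m) w"
proof -
  obtain k u where "k \<le> m" "(splice_step ^^ k) v u" "reducible_word u"
    using assms unfolding reduces_within_def by blast
  then show ?thesis unfolding reduces_within_def using assms(1)
    by (intro exI[of _ "Suc k"] conjI exI[of _ u]) (auto intro: relpowp_Suc_I2 simp del: relpowp.simps)
qed

lemma reduces_within_isolated:
  assumes "a \<in> set w" "\<And>x. x \<in> set w \<Longrightarrow> x \<noteq> a \<Longrightarrow> \<not> interlaced w a x"
  shows "reduces_within m w"
proof -
  have "reducible_word w" unfolding reducible_word_def using assms by (metis interlaced_def)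
  then show ?thesis unfolding reduces_within_def by (intro exI[of _ 0]) auto
qed

text \<open>As \<open>b\<close> is a neighbour of \<open>a\<close>, splicing at \<open>a\<close>
  adds the neighbours of \<open>a\<close> to those of \<open>b\<close> modulo 2. The two sets agree
  on all other letters, so everything cancels and \<open>b\<close> is isolated.\<close>

lemma reduces_within_adjacent_twins:
  assumes w: "double_word w" and ab: "a \<in> set w" "b \<in> set w" "a \<noteq> b" "interlaced w a b"
    and twin: "\<And>x. x \<in> set w \<Longrightarrow> x \<notin> {a, b} \<Longrightarrow> interlaced w a x = interlaced w b x"
  shows "reduces_within 1 w"
proof -
  obtain v where v: "splice_step w v" "double_word v" "set v = set w - {a}"
    "\<And>x y. x \<in> set v \<Longrightarrow> y \<in> set v \<Longrightarrow> x \<noteq> y \<Longrightarrow>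
      interlaced v x y \<longleftrightarrow> (interlaced w x y \<noteq> (interlaced w a x \<and> interlaced w a y))"
    using splice_local_complement[OF w ab(1)] by metis
  have "reduces_within 0 v"
    by (rule reduces_within_isolated[of b]) (use v ab twin in auto)
  then show ?thesis using reduces_within_splice[OF v(1)] by simp
qed

text \<open>Twins that are not interlaced become so after a splice at a common neighbour, which
  keeps them twins. Without a common neighbour, \<open>a\<close> is isolated already.\<close>

lemma reduces_within_twins:
  assumes w: "double_word w" and ab: "a \<in> set w" "b \<in> set w" "a \<noteq> b"
    and twin: "\<And>x. x \<in> set w \<Longrightarrow> x \<notin> {a, b} \<Longrightarrow> interlaced w a x = interlaced w b x"
  shows "reduces_within 2 w"
proof (cases "interlaced w a b")
  case True
  then show ?thesis using reduces_within_adjacent_twins[OF w ab True twin] by (auto intro: reduces_within_mono)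
next
  case nab: False
  show ?thesis
  proof (cases "\<exists>x\<in>set w. x \<noteq> a \<and> interlaced w a x")
    case False
    then show ?thesis using reduces_within_isolated[of a w] ab by blast
  next
    case True
    then obtain c where c: "c \<in> set w" "c \<noteq> a" "c \<noteq> b" "interlaced w a c" using nab by blast
    then have cab: "interlaced w c a" "interlaced w c b"
      using twin[of c] interlaced_commute[OF w] ab by auto
    obtain v where v: "splice_step w v" "double_word v" "set v = set w - {c}"
      "\<And>x y. x \<in> set v \<Longrightarrow> y \<in> set v \<Longrightarrow> x \<noteq> y \<Longrightarrow>
        interlaced v x y \<longleftrightarrow> (interlaced w x y \<noteq> (interlaced w c x \<and> interlaced w c y))"
      using splice_local_complement[OF w c(1)] by metis
    have "reduces_within 1 v"
      by (rule reduces_within_adjacent_twins[of v a b]) (use v c ab nab cab twin in auto)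
    then show ?thesis using reduces_within_splice[OF v(1)] by (simp add: numeral_2_eq_2)
  qed
qed

text \<open>Models the corners of a three-sided region: their neighbourhoods sum to zero modulo 2
  outside the corners. Interlacement among the corners is left free and drives the case
  analysis.\<close>

definition word_triangle :: "'a list \<Rightarrow> 'a \<Rightarrow> 'a \<Rightarrow> 'a \<Rightarrow> bool" where
  "word_triangle w a b c \<longleftrightarrow> {a, b, c} \<subseteq> set w \<and> a \<noteq> b \<and> b \<noteq> c \<and> a \<noteq> c \<and>
    (\<forall>x\<in>set w - {a, b, c}. interlaced w c x \<longleftrightarrow> interlaced w a x \<noteq> interlaced w b x)"

lemma word_triangle_permute:
  "word_triangle w a b c \<Longrightarrow> word_triangle w b a c" "word_triangle w a b c \<Longrightarrow> word_triangle w b c a"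
  unfolding word_triangle_def by auto

text \<open>Splicing at \<open>b\<close> makes \<open>a\<close> and \<open>c\<close> twins.\<close>
lemma word_triangle_splice:
  assumes w: "double_word w" and t: "word_triangle w a b c" and ab: "interlaced w a b" and nbc: "\<not> interlaced w b c"
  shows "reduces_within 3 w" "interlaced w a c \<Longrightarrow> reduces_within 2 w"
proof -
  have in_w: "a \<in> set w" "b \<in> set w" "c \<in> set w" "a \<noteq> b" "b \<noteq> c" "a \<noteq> c"
    and sum: "\<And>x. x \<in> set w - {a, b, c} \<Longrightarrow> interlaced w c x \<longleftrightarrow> interlaced w a x \<noteq> interlaced w b x"
    using t by (auto simp: word_triangle_def)
  have ba: "interlaced w b a" using ab interlaced_commute[OF w] in_w by blast
  obtain v where v: "splice_step w v" "double_word v" "set v = set w - {b}"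
    "\<And>x y. x \<in> set v \<Longrightarrow> y \<in> set v \<Longrightarrow> x \<noteq> y \<Longrightarrow>
      interlaced v x y \<longleftrightarrow> (interlaced w x y \<noteq> (interlaced w b x \<and> interlaced w b y))"
    using splice_local_complement[OF w in_w(2)] by metis
  have av: "a \<in> set v" "c \<in> set v" using v in_w by auto
  \<comment> \<open>The row of \<open>a\<close> becomes row \<open>a\<close> plus row
    \<open>b\<close>, which is row \<open>c\<close>; row \<open>c\<close> is unchanged because
    \<open>b\<close> and \<open>c\<close> are not interlaced.\<close>
  have twin: "interlaced v a x = interlaced v c x" if "x \<in> set v" "x \<notin> {a, c}" for x
    using that v(3) sum[of x] ba nbc v(4)[of a x] v(4)[of c x] av by auto
  have "reduces_within 2 v" by (rule reduces_within_twins[OF v(2) av \<open>a \<noteq> c\<close> twin])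
  then show "reduces_within 3 w" using reduces_within_splice[OF v(1)] by (simp add: numeral_3_eq_3 numeral_2_eq_2)
  assume "interlaced w a c"
  then have "interlaced v a c" using v(4)[OF av \<open>a \<noteq> c\<close>] nbc by simp
  from reduces_within_adjacent_twins[OF v(2) av \<open>a \<noteq> c\<close> this twin]
  show "reduces_within 2 w" using reduces_within_splice[OF v(1)] by (simp add: numeral_2_eq_2)
qed

text \<open>By parity \<open>x\<close> is not interlaced with \<open>c\<close>. Splicing at
  \<open>x\<close> adds the same row to \<open>a\<close> and to \<open>b\<close>, so the parity
  relation survives, and among the corners only the pair \<open>a\<close>, \<open>b\<close>
  changes.\<close>

lemma word_triangle_toggle:
  assumes w: "double_word w" and t: "word_triangle w a b c"
    and x: "x \<in> set w" "x \<notin> {a, b, c}" "interlaced w x a" "interlaced w x b"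
  obtains v where "splice_step w v" "double_word v" "word_triangle v a b c"
    "interlaced v a b \<longleftrightarrow> \<not> interlaced w a b" "interlaced v a c = interlaced w a c"
    "interlaced v b c = interlaced w b c"
proof -
  have in_w: "a \<in> set w" "b \<in> set w" "c \<in> set w" "a \<noteq> b" "b \<noteq> c" "a \<noteq> c"
    and sum: "\<And>x. x \<in> set w - {a, b, c} \<Longrightarrow> interlaced w c x \<longleftrightarrow> interlaced w a x \<noteq> interlaced w b x"
    using t by (auto simp: word_triangle_def)
  have xc: "\<not> interlaced w x c" using sum[of x] x in_w interlaced_commute[OF w] by auto
  obtain v where v: "splice_step w v" "double_word v" "set v = set w - {x}"
    "\<And>y z. y \<in> set v \<Longrightarrow> z \<in> set v \<Longrightarrow> y \<noteq> z \<Longrightarrow>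
      interlaced v y z \<longleftrightarrow> (interlaced w y z \<noteq> (interlaced w x y \<and> interlaced w x z))"
    using splice_local_complement[OF w x(1)] by metis
  have in_v: "a \<in> set v" "b \<in> set v" "c \<in> set v" using v x in_w by auto
  have "word_triangle v a b c"
    unfolding word_triangle_def using in_w in_v sum x xc v(3,4) by auto
  then show ?thesis using that[OF v(1,2)] v(4) in_w in_v x xc by auto
qed

lemma reduces_within_triangle_edge:
  assumes w: "double_word w" and t: "word_triangle w a b c"
    and e: "interlaced w a b \<or> interlaced w a c \<or> interlaced w b c"
  shows "reduces_within 3 w"
proof -
  have in_w: "a \<in> set w" "b \<in> set w" "c \<in> set w" "a \<noteq> b" "b \<noteq> c" "a \<noteq> c"
    and sum: "\<And>x. x \<in> set w - {a, b, c} \<Longrightarrow> interlaced w c x \<longleftrightarrow> interlaced w a x \<noteq> interlaced w b x"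
    using t by (auto simp: word_triangle_def)
  note sym = interlaced_commute[OF w in_w(1,2)] interlaced_commute[OF w in_w(1,3)] interlaced_commute[OF w in_w(2,3)]
  note T = t word_triangle_permute(1)[OF t] word_triangle_permute(2)[OF t]
    word_triangle_permute(2)[OF word_triangle_permute(1)[OF t]]
    word_triangle_permute(1)[OF word_triangle_permute(2)[OF t]]
    word_triangle_permute(2)[OF word_triangle_permute(2)[OF t]]
  show ?thesis
  proof (cases "interlaced w a b \<and> interlaced w a c \<and> interlaced w b c")
    case False
    \<comment> \<open>When some but not all pairs are interlaced, some corner is interlaced with
      exactly one of the other two; one of the six permutations puts it in the role of
      \<open>b\<close>.\<close>
    then show ?thesis using e sym T(1-6)[THEN word_triangle_splice(1)[OF w]] by metis
  next
    case full: True
    show ?thesis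
    proof (cases "\<exists>x\<in>set w - {a, b, c}. interlaced w a x")
      case True
      then obtain x where x: "x \<in> set w" "x \<notin> {a, b, c}" "interlaced w x a"
        using interlaced_commute[OF w] in_w by blast
      \<comment> \<open>Parity again: apart from \<open>a\<close>, the letter \<open>x\<close> meets
        exactly one corner. Toggling that pair leaves two interlaced pairs meeting at the third
        corner, the configuration that costs two splices.\<close>
      have "interlaced w x b \<or> interlaced w x c" using x sum[of x] interlaced_commute[OF w] in_w by auto
      moreover have ?thesis if tri: "word_triangle w a b' c'" and xb: "interlaced w x b'"
        and E: "interlaced w a b'" "interlaced w a c'" "interlaced w b' c'" and "x \<notin> {a, b', c'}" for b' c'
      proof -
        obtain v where v: "splice_step w v" "double_word v" "word_triangle v a b' c'"
          "interlaced v a b' \<longleftrightarrow> \<not> interlaced w a b'" "interlaced v a c' = interlaced w a c'"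
          "interlaced v b' c' = interlaced w b' c'"
          by (rule word_triangle_toggle[OF w tri x(1) \<open>x \<notin> {a, b', c'}\<close> x(3) xb]) 
        have "word_triangle v c' a b'" using v(3) word_triangle_permute by metis
        moreover have m: "{a, b', c'} \<subseteq> set v" using v(3) by (simp add: word_triangle_def)
        moreover have "interlaced v c' a" "interlaced v c' b'" 
          using v(5,6) E m interlaced_commute[OF v(2), of c'] by auto
        moreover have "\<not> interlaced v a b'" using v(4) E by simp
        ultimately have "reduces_within 2 v" using word_triangle_splice(2)[OF v(2)] by metis
        then show ?thesis using reduces_within_splice[OF v(1)] by (simp add: numeral_3_eq_3 numeral_2_eq_2)
      qed
      ultimately show ?thesis using T full x(2) sym by blast
    next
      case False
      \<comment> \<open>If \<open>a\<close> has no outside neighbour, parity makes \<open>b\<close>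
        and \<open>c\<close> twins, and splicing at \<open>a\<close> changes only the pair
        \<open>b\<close>, \<open>c\<close>.\<close>
      obtain v where v: "splice_step w v" "double_word v" "set v = set w - {a}"
        "\<And>x y. x \<in> set v \<Longrightarrow> y \<in> set v \<Longrightarrow> x \<noteq> y \<Longrightarrow>
          interlaced v x y \<longleftrightarrow> (interlaced w x y \<noteq> (interlaced w a x \<and> interlaced w a y))"
        using splice_local_complement[OF w in_w(1)] by metis
      have bv: "b \<in> set v" "c \<in> set v" using v in_w by auto
      have nbc: "interlaced v b x = interlaced v c x" if "x \<in> set v" "x \<notin> {b, c}" for x
        using that sum[of x] v(3) v(4)[of b x] v(4)[of c x] bv False by auto
      then have "reduces_within 2 v" by (rule reduces_within_twins[OF v(2) bv \<open>b \<noteq> c\<close>])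
      then show ?thesis using reduces_within_splice[OF v(1)] by (simp add: numeral_3_eq_3 numeral_2_eq_2)
    qed
  qed
qed

text \<open>The fourth splice is spent when no two corners are interlaced: a splice at an outside
  letter that meets two corners makes these two interlaced. If \<open>a\<close> meets no outside
  letter it is isolated.\<close>

lemma reduces_within_triangle:
  assumes w: "double_word w" and t: "word_triangle w a b c"
  shows "reduces_within 4 w"
proof (cases "interlaced w a b \<or> interlaced w a c \<or> interlaced w b c")
  case True
  then show ?thesis using reduces_within_triangle_edge[OF w t] by (auto intro: reduces_within_mono)
next
  case nE: False
  have in_w: "a \<in> set w" "b \<in> set w" "c \<in> set w" "a \<noteq> b" "b \<noteq> c" "a \<noteq> c"
    and sum: "\<And>x. x \<in> set w - {a, b, c} \<Longrightarrow> interlaced w c x \<longleftrightarrow> interlaced w a x \<noteq> interlaced w b x"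
    using t by (auto simp: word_triangle_def)
  show ?thesis
  proof (cases "\<exists>x\<in>set w - {a, b, c}. interlaced w a x")
    case True
    then obtain x where x: "x \<in> set w" "x \<notin> {a, b, c}" "interlaced w x a"
      using interlaced_commute[OF w] in_w by blast
    have "interlaced w x b \<or> interlaced w x c" using x sum[of x] interlaced_commute[OF w] in_w by auto
    moreover have ?thesis if tri: "word_triangle w a b' c'" and xb: "interlaced w x b'"
      and E: "\<not> interlaced w a b'" and "x \<notin> {a, b', c'}" for b' c'
    proof -
      obtain v where "splice_step w v" "double_word v" "word_triangle v a b' c'"
        "interlaced v a b' \<longleftrightarrow> \<not> interlaced w a b'" 
        by (rule word_triangle_toggle[OF w tri x(1) \<open>x \<notin> {a, b', c'}\<close> x(3) xb])
      then show ?thesis using reduces_within_triangle_edge[of v a b' c'] E reduces_within_splice[of w v 3]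
        by simp
    qed
    moreover have "word_triangle w a c b" using t word_triangle_permute by metis
    ultimately show ?thesis using t nE x(2) by blast
  next
    case False
    then show ?thesis using reduces_within_isolated[of a w] in_w nE by blast
  qed
qed

section \<open>Small faces by counting colourings\<close>

lemma odd_card_filter_neq:
  assumes "finite Q"
  shows "odd (card {p\<in>Q. f p \<noteq> g p}) \<longleftrightarrow> odd (card {p\<in>Q. f p}) \<noteq> odd (card {p\<in>Q. g p})"
  using assms
proof (induction Q)
  case (insert q Q)
  have *: "{p \<in> insert q Q. h p} = (if h q then insert q {p\<in>Q. h p} else {p\<in>Q. h p})" for h by auto
  show ?case using insert unfolding * by auto
qed simp

text \<open>Used with \<open>S\<close> the darts and \<open>P\<close> the letters. If all fibres had
  four elements there would be at most \<open>card P\<close> colour vectors, hence at most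
  \<open>2 ^ card P\<close> sets of vectors, but independence yields twice as many parity
  functions.\<close>

lemma small_fibre_if_independent:
  fixes f :: "'p \<Rightarrow> 's \<Rightarrow> bool"
  assumes "finite S" "finite P" "card S \<le> 4 * card P"
    and indep: "\<And>Q Q' b b'. Q \<subseteq> P \<Longrightarrow> Q' \<subseteq> P \<Longrightarrow>
      \<forall>x\<in>S. (odd (card {p\<in>Q. f p x}) \<noteq> b) = (odd (card {p\<in>Q'. f p x}) \<noteq> b') \<Longrightarrow> Q = Q' \<and> b = b'"
  obtains x where "x \<in> S" "card {y\<in>S. \<forall>p\<in>P. f p y = f p x} \<le> 3"
proof (rule ccontr)
  assume "\<not> thesis"
  then have big: "4 \<le> card {y\<in>S. \<forall>p\<in>P. f p y = f p x}" if "x \<in> S" for x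
    using that \<open>\<And>x. x \<in> S \<Longrightarrow> card {y\<in>S. \<forall>p\<in>P. f p y = f p x} \<le> 3 \<Longrightarrow> thesis\<close> by fastforce
  define c where "c = (\<lambda>x. {p\<in>P. f p x})"
  have fib: "{y\<in>S. c y = c x} = {y\<in>S. \<forall>p\<in>P. f p y = f p x}" for x unfolding c_def by auto
  have "4 * card (c ` S) = (\<Sum>X\<in>c ` S. 4)" by simp
  also have "\<dots> \<le> (\<Sum>X\<in>c ` S. card {y\<in>S. c y = X})"
    by (rule sum_mono) (use big in \<open>auto simp: fib\<close>)
  also have "\<dots> = card S"
    using sum.image_gen[OF \<open>finite S\<close>, of "\<lambda>_. 1::nat" c] by simp
  finally have le: "card (c ` S) \<le> card P" using assms by simp
  \<comment> \<open>The parity over \<open>Q\<close> depends on a dart only through its colour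
    vector \<open>c x\<close>, so each pair of a \<open>Q\<close> and a constant \<open>b\<close>
    defines a set of vectors.\<close>
  define G where "G = (\<lambda>(Q, b). {X\<in>c ` S. odd (card (X \<inter> Q)) \<noteq> b})"
  have cQ: "c x \<inter> Q = {p\<in>Q. f p x}" if "Q \<subseteq> P" for x Q using that by (auto simp: c_def)
  have "inj_on G (Pow P \<times> UNIV)"
  proof (rule inj_onI)
    fix y z assume yz: "y \<in> Pow P \<times> UNIV" "z \<in> Pow P \<times> UNIV" "G y = G z"
    obtain Q b Q' b' where e: "y = (Q, b)" "z = (Q', b')" by fastforce
    have "(odd (card {p\<in>Q. f p x}) \<noteq> b) = (odd (card {p\<in>Q'. f p x}) \<noteq> b')" if "x \<in> S" for x
    proof -
      have "c x \<in> G y \<longleftrightarrow> c x \<in> G z" using yz by simp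
      then show ?thesis using that yz unfolding e G_def by (simp add: cQ)
    qed
    then show "y = z" using indep[of Q Q' b b'] yz e by auto
  qed
  moreover have "G ` (Pow P \<times> UNIV) \<subseteq> Pow (c ` S)" by (auto simp: G_def)
  ultimately have "card (Pow P \<times> (UNIV :: bool set)) \<le> card (Pow (c ` S))"
    using \<open>finite S\<close> by (intro card_inj_on_le) auto
  then have "2 ^ card P * 2 \<le> (2::nat) ^ card (c ` S)"
    using assms by (simp add: card_cartesian_product card_Pow)
  also have "\<dots> \<le> 2 ^ card P" using le by simp
  finally show False by simp
qed

section \<open>Darts, boundary walks and the small face\<close>

definition cyc_succ :: "nat \<Rightarrow> nat \<Rightarrow> nat" where
  "cyc_succ N j = (if Suc j = N then 0 else Suc j)"

definition cyc_pred :: "nat \<Rightarrow> nat \<Rightarrow> nat" where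
  "cyc_pred N j = (if j = 0 then N - 1 else j - 1)"

lemma cyc_less: "j < N \<Longrightarrow> cyc_succ N j < N" "j < N \<Longrightarrow> cyc_pred N j < N"
  by (auto simp: cyc_succ_def cyc_pred_def)

lemma cyc_inverse: "j < N \<Longrightarrow> cyc_pred N (cyc_succ N j) = j" "j < N \<Longrightarrow> cyc_succ N (cyc_pred N j) = j"
  by (auto simp: cyc_succ_def cyc_pred_def)

text \<open>A dart \<open>(j, d)\<close> leaves position \<open>j\<close> of the cyclic word forwards or backwards.  At its end
  \<open>k\<close> the boundary walk turns left into the other strand, which is followed forwards if it crosses
  the current one from right to left; \<open>\<epsilon> k\<close> says so for the forward orientation of position \<open>k\<close>.\<close>
definition dart_end :: "nat \<Rightarrow> nat \<times> bool \<Rightarrow> nat" where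
  "dart_end N x = (if snd x then cyc_succ N (fst x) else cyc_pred N (fst x))"

definition next_dart :: "nat \<Rightarrow> (nat \<Rightarrow> nat) \<Rightarrow> (nat \<Rightarrow> bool) \<Rightarrow> nat \<times> bool \<Rightarrow> nat \<times> bool" where
  "next_dart N \<tau> \<epsilon> x = (\<tau> (dart_end N x), snd x = \<epsilon> (dart_end N x))"

text \<open>Cyclic neighbours can lie on different sides of \<open>x1\<close> and \<open>x2\<close>
  only if one of them is an endpoint. For the wraparound step, \<open>0\<close> and
  \<open>N - 1\<close> are then both outside.\<close>

lemma adjacent_positions_separated:
  assumes "fst x < N" "x1 < x2" "x2 < N" "fst x \<notin> {x1, x2}" "dart_end N x \<notin> {x1, x2}"
  shows "(x1 < fst x \<and> fst x < x2) = (x1 < dart_end N x \<and> dart_end N x < x2)"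
  using assms by (auto simp: dart_end_def cyc_succ_def cyc_pred_def split: if_splits)

lemma double_word_length:
  assumes "double_word w" shows "length w = 2 * card (set w)"
proof -
  have "length w = sum (count_list w) (set w)" by (simp add: sum_count_set)
  also have "\<dots> = (\<Sum>x\<in>set w. 2)" by (rule sum.cong) (use assms in \<open>auto simp: double_word_def\<close>)
  finally show ?thesis by simp
qed

lemma double_word_positions:
  assumes "double_word w" "i < length w" "j < length w" "i \<noteq> j" "w ! i = w ! j"
  shows "{k. k < length w \<and> w ! k = w ! i} = {i, j}"
proof -
  have "card {k. k < length w \<and> w ! k = w ! i} = 2"
    unfolding card_positions using assms by (simp add: double_word_def)
  moreover have "{i, j} \<subseteq> {k. k < length w \<and> w ! k = w ! i}" "card {i, j} = 2" using assms by auto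
  ultimately show ?thesis by (metis card_subset_eq finite_Collect_conjI finite_Collect_less_nat)
qed

text \<open>Combinatorial interface to the topology. In \<open>jump\<close>, the two darts are the
  two sides of edge \<open>k\<close>, and the count is odd exactly when the edge lies between the
  two occurrences of \<open>p\<close>, that is, on the loop based at \<open>p\<close>.\<close>

locale coloured_word =
  fixes w :: "'a list" and \<tau> :: "nat \<Rightarrow> nat" and \<epsilon> :: "nat \<Rightarrow> bool" and f :: "'a \<Rightarrow> nat \<times> bool \<Rightarrow> bool"
  assumes double: "double_word w" and nonempty: "w \<noteq> []"
    and partner: "\<And>k. k < length w \<Longrightarrow> \<tau> k < length w \<and> \<tau> k \<noteq> k \<and> w ! \<tau> k = w ! k"
    and invariant: "\<And>p x. p \<in> set w \<Longrightarrow> fst x < length w \<Longrightarrow>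
      f p (next_dart (length w) \<tau> \<epsilon> x) = f p x"
    and jump: "\<And>p k. p \<in> set w \<Longrightarrow> k < length w \<Longrightarrow>
      f p (k, True) \<noteq> f p (cyc_succ (length w) k, False) \<longleftrightarrow> odd (card {m. m \<le> k \<and> w ! m = p})"
begin

abbreviation "N \<equiv> length w"
abbreviation "\<phi> \<equiv> next_dart N \<tau> \<epsilon>"
abbreviation "dest \<equiv> dart_end N"

lemma partner_partner: "k < N \<Longrightarrow> \<tau> (\<tau> k) = k"
  using double_word_positions[OF double, of k "\<tau> k"] partner[of k] partner[of "\<tau> k"] by auto

lemma dest_less: "fst x < N \<Longrightarrow> dest x < N"
  by (simp add: dart_end_def cyc_less)

lemma next_dart_less: "fst x < N \<Longrightarrow> fst (\<phi> x) < N"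
  by (simp add: next_dart_def dest_less partner)

lemma next_dart_inj:
  assumes "fst x < N" "fst y < N" "\<phi> x = \<phi> y"
  shows "x = y"
proof -
  have "\<tau> (dest x) = \<tau> (dest y)" using assms by (simp add: next_dart_def)
  then have d: "dest x = dest y" using partner_partner dest_less assms by metis
  then have s: "snd x = snd y" using assms by (auto simp: next_dart_def)
  have "fst x = fst y"
    using d s cyc_inverse[OF assms(1)] cyc_inverse[OF assms(2)] unfolding dart_end_def
    by (metis (full_types))
  then show ?thesis using s by (simp add: prod_eq_iff)
qed

text \<open>Comparing the two sides of one edge cancels the constant and leaves the parity
  \<open>J\<close>. Consecutive values of \<open>J\<close> differ exactly where the word has a
  letter of \<open>Q\<close>, so \<open>Q\<close> can be read off; the constant then follows at a
  single dart.\<close>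

lemma letter_colour_independent:
  assumes "Q \<subseteq> set w" "Q' \<subseteq> set w"
    and eq: "\<forall>x\<in>{..<N} \<times> UNIV. (odd (card {p\<in>Q. f p x}) \<noteq> b) = (odd (card {p\<in>Q'. f p x}) \<noteq> b')"
  shows "Q = Q' \<and> b = b'"
proof -
  define J where "J = (\<lambda>Q k. odd (card {p\<in>Q. odd (card {m. m \<le> k \<and> w ! m = p})}))"
  have jump_Q: "(odd (card {p\<in>R. f p (k, True)}) \<noteq> odd (card {p\<in>R. f p (cyc_succ N k, False)})) = J R k"
    if "k < N" "R \<subseteq> set w" for R k
  proof -
    have "finite R" using that finite_subset by blast
    have "{p\<in>R. f p (k, True) \<noteq> f p (cyc_succ N k, False)} = {p\<in>R. odd (card {m. m \<le> k \<and> w ! m = p})}"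
      using jump that by blast
    then show ?thesis using odd_card_filter_neq[OF \<open>finite R\<close>, of "\<lambda>p. f p (k, True)" "\<lambda>p. f p (cyc_succ N k, False)"]
      unfolding J_def by simp
  qed
  have JJ: "J Q k = J Q' k" if "k < N" for k
  proof -
    have "(odd (card {p\<in>Q. f p (k, True)}) \<noteq> b) = (odd (card {p\<in>Q'. f p (k, True)}) \<noteq> b')"
      "(odd (card {p\<in>Q. f p (cyc_succ N k, False)}) \<noteq> b) = (odd (card {p\<in>Q'. f p (cyc_succ N k, False)}) \<noteq> b')"
      using eq that cyc_less(1)[OF that] by auto
    then show ?thesis using jump_Q[OF that assms(1)] jump_Q[OF that assms(2)] by argo
  qed
  \<comment> \<open>Position \<open>k\<close> changes the count of the letter \<open>w ! k\<close>
    only. Before position 0 every count is zero, whence the guard \<open>k > 0\<close>.\<close>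
  have mem: "w ! k \<in> R \<longleftrightarrow> J R k \<noteq> (k > 0 \<and> J R (k - 1))" if "k < N" "R \<subseteq> set w" for R k
  proof -
    have "finite R" using that finite_subset by blast
    have one: "odd (card {p\<in>R. p = w ! k}) \<longleftrightarrow> w ! k \<in> R"
    proof -
      have "{p\<in>R. p = w ! k} = (if w ! k \<in> R then {w ! k} else {})" by auto
      then show ?thesis by simp
    qed
    show ?thesis
    proof (cases k)
      case 0
      have "{m. m \<le> 0 \<and> w ! m = p} = (if p = w ! 0 then {0} else {})" for p by auto
      then have "{p\<in>R. odd (card {m. m \<le> k \<and> w ! m = p})} = {p\<in>R. p = w ! k}" using 0 by auto
      then show ?thesis using 0 one by (simp add: J_def)
    next
      case (Suc l)
      have "{m. m \<le> Suc l \<and> w ! m = p} = (if p = w ! Suc l then insert (Suc l) {m. m \<le> l \<and> w ! m = p}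
          else {m. m \<le> l \<and> w ! m = p})" for p
        by (auto simp: le_Suc_eq)
      then have "{p\<in>R. p = w ! k} =
        {p\<in>R. odd (card {m. m \<le> k \<and> w ! m = p}) \<noteq> odd (card {m. m \<le> l \<and> w ! m = p})}"
        using Suc by auto
      then have "w ! k \<in> R \<longleftrightarrow> J R k \<noteq> J R l"
        unfolding J_def one[symmetric] by (simp only: odd_card_filter_neq[OF \<open>finite R\<close>])
      then show ?thesis using Suc by simp
    qed
  qed
  have "x \<in> Q \<longleftrightarrow> x \<in> Q'" if "x \<in> set w" for x
  proof -
    obtain k where k: "k < N" "w ! k = x" using \<open>x \<in> set w\<close> by (auto simp: in_set_conv_nth)
    then have "k - 1 < N" by simp
    then show ?thesis using mem[OF k(1) assms(1)] mem[OF k(1) assms(2)] JJ[OF k(1)] JJ[OF \<open>k - 1 < N\<close>] k(2) by auto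
  qed
  then have "Q = Q'" using assms by blast
  moreover have "(0, True) \<in> {..<N} \<times> UNIV" using nonempty by simp
  ultimately show ?thesis using eq by blast
qed

text \<open>A dart and its next three images share all colours, so in a fibre of at most three darts
  two of them coincide; injectivity carries the coincidence back to \<open>x\<close>.\<close>

lemma small_face:
  obtains x where "fst x < N" "\<phi> x = x \<or> \<phi> (\<phi> x) = x \<or> \<phi> (\<phi> (\<phi> x)) = x"
proof -
  let ?S = "{..<N} \<times> (UNIV :: bool set)"
  have fin: "finite ?S" "finite (set w)" by auto
  have "card ?S \<le> 4 * card (set w)" using double_word_length[OF double] by (simp add: card_cartesian_product)
  then obtain x where x: "x \<in> ?S" "card {y\<in>?S. \<forall>p\<in>set w. f p y = f p x} \<le> 3"
    by (rule small_fibre_if_independent[OF fin _ letter_colour_independent])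
  let ?F = "{y\<in>?S. \<forall>p\<in>set w. f p y = f p x}"
  have lt: "fst x < N" using x by auto
  note lts = next_dart_less[OF lt] next_dart_less[OF next_dart_less[OF lt]]
    next_dart_less[OF next_dart_less[OF next_dart_less[OF lt]]]
  have mem: "y \<in> ?S" if "fst y < N" for y using that by (simp add: mem_Times_iff)
  have "{x, \<phi> x, \<phi> (\<phi> x), \<phi> (\<phi> (\<phi> x))} \<subseteq> ?F"
    using x lt lts mem by (auto simp: invariant)
  moreover have "finite ?F" by simp
  ultimately have "card {x, \<phi> x, \<phi> (\<phi> x), \<phi> (\<phi> (\<phi> x))} \<le> 3" using x(2) by (meson card_mono order_trans)
  then have "\<not> distinct [x, \<phi> x, \<phi> (\<phi> x), \<phi> (\<phi> (\<phi> x))]" using distinct_card by fastforce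
  then have "x = \<phi> x \<or> x = \<phi> (\<phi> x) \<or> x = \<phi> (\<phi> (\<phi> x)) \<or> \<phi> x = \<phi> (\<phi> x) \<or> \<phi> x = \<phi> (\<phi> (\<phi> x)) \<or> \<phi> (\<phi> x) = \<phi> (\<phi> (\<phi> x))"
    by auto
  then have "\<phi> x = x \<or> \<phi> (\<phi> x) = x \<or> \<phi> (\<phi> (\<phi> x)) = x"
    using next_dart_inj lt lts by metis
  then show ?thesis using that lt by blast
qed

lemma interlaced_partner:
  assumes "x1 < x2" "x2 < N" "w ! x1 = w ! x2" "i < N" "w ! i \<noteq> w ! x1"
  shows "interlaced w (w ! x1) (w ! i) \<longleftrightarrow> (x1 < i \<and> i < x2) \<noteq> (x1 < \<tau> i \<and> \<tau> i < x2)"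
  using assms partner[of i] by (intro interlaced_iff_separated[OF double]) auto

text \<open>An edge that returns to its own crossing makes the two occurrences of that letter cyclic
  neighbours, so no other chord separates them.\<close>

lemma loop_dart_reducible:
  assumes "fst x < N" "w ! fst x = w ! dest x"
  shows "reduces_within m w"
proof -
  let ?i = "fst x" and ?k = "dest x"
  have k: "?k < N" using assms dest_less by blast
  have "?k \<noteq> ?i"
  proof
    assume "?k = ?i"
    \<comment> \<open>Only a word of length at most 1 has a position that is its own neighbour, and
      lengths of double occurrence words are even.\<close>
    then have "N < 2" using assms(1) by (auto simp: dart_end_def cyc_succ_def cyc_pred_def split: if_splits)
    then have "N = 0" using double_word_length[OF double] by presburger
    then show False using nonempty by simp
  qed
  then have tau: "\<tau> ?i = ?k" using double_word_positions[OF double assms(1) k _ assms(2)] partner[OF assms(1)] by auto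
  show ?thesis
  proof (rule reduces_within_isolated)
    show m: "w ! ?i \<in> set w" using assms(1) by simp
    fix y assume y: "y \<in> set w" "y \<noteq> w ! ?i"
    then obtain j where j: "j < N" "w ! j = y" by (auto simp: in_set_conv_nth)
    define x1 x2 where "x1 = min j (\<tau> j)" and "x2 = max j (\<tau> j)"
    have x12: "x1 < x2" "x2 < N" "w ! x1 = y" "w ! x2 = y" using j partner[of j] by (auto simp: x1_def x2_def min_def max_def)
    have n: "?i \<notin> {x1, x2}" "?k \<notin> {x1, x2}" using x12 y assms(2) by auto
    have "\<not> interlaced w y (w ! ?i)"
      using interlaced_partner[of x1 x2 ?i] adjacent_positions_separated[OF assms(1) x12(1,2) n]
        assms(1) tau x12 y(2) by simp
    then show "\<not> interlaced w (w ! ?i) y" using interlaced_commute[OF double m y(1)] by simp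
  qed
qed

text \<open>Walk round the face and record, for a further letter \<open>q\<close>, whether the
  current position lies between its occurrences. Edges keep the record; a corner changes it exactly
  when interlaced with \<open>q\<close>. A closed walk has evenly many changes: two sides give
  twins, three a \<open>word_triangle\<close>.\<close>

theorem reduces_within_4: "reduces_within 4 w"
proof -
  obtain x where x: "fst x < N" "\<phi> x = x \<or> \<phi> (\<phi> x) = x \<or> \<phi> (\<phi> (\<phi> x)) = x" by (rule small_face)
  define y z where "y = \<phi> x" and "z = \<phi> y"
  have y: "fst y < N" and z: "fst z < N" using x next_dart_less by (auto simp: y_def z_def)
  have ends: "w ! fst (\<phi> u) = w ! dest u" if "fst u < N" for u
    using partner[OF dest_less[OF that]] by (simp add: next_dart_def)
  have fst_next: "fst (\<phi> u) = \<tau> (dest u)" for u by (simp add: next_dart_def)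
  \<comment> \<open>Set apart because twins and triangles need distinct corners; excluding such
    edges also excludes one-sided faces.\<close>
  have loop: ?thesis if "\<exists>u. fst u < N \<and> w ! fst u = w ! dest u" using that loop_dart_reducible by blast
  have sep: "\<exists>x1 x2. x1 < x2 \<and> x2 < N \<and> w ! x1 = q \<and> w ! x2 = q" if q: "q \<in> set w" for q
  proof -
    obtain j where j: "j < N" "w ! j = q" using q by (auto simp: in_set_conv_nth)
    then show ?thesis using partner[of j] by (metis linorder_neqE_nat)
  qed
  show ?thesis
  proof (cases "\<exists>u. fst u < N \<and> w ! fst u = w ! dest u")
    case False
    consider "\<phi> x = x" | "\<phi> y = x" | "\<phi> z = x" using x by (auto simp: y_def z_def)
    then show ?thesis
    proof cases
      case 1
      then show ?thesis using ends[OF x(1)] False x(1) by metis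
    next
      case 2
      let ?a = "w ! fst x" and ?b = "w ! fst y"
      have ab: "?a \<noteq> ?b" using ends[OF x(1)] False x(1) by (metis y_def)
      have "reduces_within 2 w"
      proof (rule reduces_within_twins[OF double _ _ ab])
        fix q assume q: "q \<in> set w" "q \<notin> {?a, ?b}"
        obtain x1 x2 where x12: "x1 < x2" "x2 < N" "w ! x1 = q" "w ! x2 = q" using sep[OF q(1)] by blast
        have e: "w ! dest x = ?b" "w ! dest y = ?a" using ends[OF x(1)] ends[OF y] 2 by (auto simp: y_def)
        have n: "fst x \<notin> {x1, x2}" "dest x \<notin> {x1, x2}" "fst y \<notin> {x1, x2}" "dest y \<notin> {x1, x2}"
          using q x12 e by auto
        have t: "\<tau> (dest x) = fst y" "\<tau> (dest y) = fst x" using fst_next[of x] fst_next[of y] 2 by (auto simp: y_def)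
        have "interlaced w q ?b \<longleftrightarrow> (x1 < dest x \<and> dest x < x2) \<noteq> (x1 < fst y \<and> fst y < x2)"
          "interlaced w q ?a \<longleftrightarrow> (x1 < dest y \<and> dest y < x2) \<noteq> (x1 < fst x \<and> fst x < x2)"
          using interlaced_partner[of x1 x2 "dest x"] interlaced_partner[of x1 x2 "dest y"] x12 e t q
            dest_less[OF x(1)] dest_less[OF y] by auto
        then have "interlaced w q ?a = interlaced w q ?b"
          using adjacent_positions_separated[OF x(1) x12(1,2) n(1,2)] adjacent_positions_separated[OF y x12(1,2) n(3,4)]
          by argo
        then show "interlaced w ?a q = interlaced w ?b q" 
          using interlaced_commute[OF double _ q(1)] x(1) y by simp
      qed (use x y in auto)
      then show ?thesis by (rule reduces_within_mono) simp
    next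
      case 3
      let ?a = "w ! fst x" and ?b = "w ! fst y" and ?c = "w ! fst z"
      have e: "w ! dest x = ?b" "w ! dest y = ?c" "w ! dest z = ?a"
        using ends[OF x(1)] ends[OF y] ends[OF z] 3 by (auto simp: y_def z_def)
      have d: "?a \<noteq> ?b" "?b \<noteq> ?c" "?a \<noteq> ?c" using e False x(1) y z by metis+
      have "word_triangle w ?a ?b ?c"
        unfolding word_triangle_def
      proof (intro conjI ballI d)
        fix q assume "q \<in> set w - {?a, ?b, ?c}"
        then have q: "q \<in> set w" "q \<notin> {?a, ?b, ?c}" by auto
        obtain x1 x2 where x12: "x1 < x2" "x2 < N" "w ! x1 = q" "w ! x2 = q" using sep[OF q(1)] by blast
        have n: "fst x \<notin> {x1, x2}" "dest x \<notin> {x1, x2}" "fst y \<notin> {x1, x2}" "dest y \<notin> {x1, x2}"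
          "fst z \<notin> {x1, x2}" "dest z \<notin> {x1, x2}"
          using q x12 e by auto
        have t: "\<tau> (dest x) = fst y" "\<tau> (dest y) = fst z" "\<tau> (dest z) = fst x"
          using fst_next[of x] fst_next[of y] fst_next[of z] 3 by (auto simp: y_def z_def)
        have "interlaced w q ?b \<longleftrightarrow> (x1 < dest x \<and> dest x < x2) \<noteq> (x1 < fst y \<and> fst y < x2)"
          "interlaced w q ?c \<longleftrightarrow> (x1 < dest y \<and> dest y < x2) \<noteq> (x1 < fst z \<and> fst z < x2)"
          "interlaced w q ?a \<longleftrightarrow> (x1 < dest z \<and> dest z < x2) \<noteq> (x1 < fst x \<and> fst x < x2)"
          using interlaced_partner[of x1 x2 "dest x"] interlaced_partner[of x1 x2 "dest y"] 
            interlaced_partner[of x1 x2 "dest z"] x12 e t q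
            dest_less[OF x(1)] dest_less[OF y] dest_less[OF z] by auto
        then have "interlaced w q ?c \<longleftrightarrow> interlaced w q ?a \<noteq> interlaced w q ?b"
          using adjacent_positions_separated[OF x(1) x12(1,2) n(1,2)] adjacent_positions_separated[OF y x12(1,2) n(3,4)]
            adjacent_positions_separated[OF z x12(1,2) n(5,6)]
          by argo
        then show "interlaced w ?c q \<longleftrightarrow> interlaced w ?a q \<noteq> interlaced w ?b q" 
          using interlaced_commute[OF double _ q(1)] x(1) y z by simp
      qed (use x y z in auto)
      then show ?thesis using reduces_within_triangle[OF double] by blast
    qed
  qed (use loop in blast)
qed

end

section \<open>Sides of an arc and corners of a crossing\<close>

text \<open>Strict differentiability: both points vary near \<open>t\<close>. A derivative based at
  \<open>t\<close> alone would not compare two nearby curve points, as the cone condition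
  must.\<close>

definition strict_deriv :: "(real \<Rightarrow> complex) \<Rightarrow> real \<Rightarrow> complex \<Rightarrow> bool" where
  "strict_deriv h t v \<longleftrightarrow> (\<forall>e>0. \<exists>d>0. \<forall>u u'. \<bar>u - t\<bar> < d \<longrightarrow> \<bar>u' - t\<bar> < d \<longrightarrow>
     norm (h u - h u' - (u - u') *\<^sub>R v) \<le> e * \<bar>u - u'\<bar>)"

lemma strict_derivI:
  assumes der: "\<And>s. (h has_vector_derivative h' s) (at s)" and cont: "isCont h' t"
  shows "strict_deriv h t (h' t)"
  unfolding strict_deriv_def
proof (intro allI impI)
  fix e :: real assume "e > 0"
  then obtain d where d: "d > 0" "\<And>s. dist s t < d \<Longrightarrow> dist (h' s) (h' t) < e"
    using cont unfolding continuous_at_eps_delta by blast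
  have "norm (h u - h u' - (u - u') *\<^sub>R h' t) \<le> e * \<bar>u - u'\<bar>" if "\<bar>u - t\<bar> < d" "\<bar>u' - t\<bar> < d" for u u'
  proof -
    have "norm (h u - h u' - (u - u') *\<^sub>R h' t) \<le> norm (u - u') * e"
    proof (rule vector_differentiable_bound_linearization[of "ball t d" h h'])
      show "closed_segment u' u \<subseteq> ball t d"
        using that by (intro closed_segment_subset) (auto simp: dist_real_def)
      show "norm (h' s - h' t) \<le> e" if "s \<in> ball t d" for s
        using d(2)[of s] that by (simp add: dist_commute dist_norm norm_minus_commute)
    qed (use d(1) der in \<open>auto intro: has_vector_derivative_at_within\<close>)
    then show ?thesis by (simp add: mult.commute)
  qed
  then show "\<exists>d>0. \<forall>u u'. \<bar>u - t\<bar> < d \<longrightarrow> \<bar>u' - t\<bar> < d \<longrightarrow> norm (h u - h u' - (u - u') *\<^sub>R h' t) \<le> e * \<bar>u - u'\<bar>"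
    using d(1) by blast
qed

lemma strict_deriv_linear_image:
  assumes "strict_deriv h t v" "bounded_linear L"
  shows "strict_deriv (\<lambda>u. L (h u - c)) t (L v)"
  unfolding strict_deriv_def
proof (intro allI impI)
  fix e :: real assume "e > 0"
  obtain B where B: "B > 0" "\<And>x. norm (L x) \<le> norm x * B" using bounded_linear.pos_bounded[OF assms(2)] by blast
  interpret L: bounded_linear L by fact
  obtain d where d: "d > 0" "\<And>u u'. \<bar>u - t\<bar> < d \<Longrightarrow> \<bar>u' - t\<bar> < d \<Longrightarrow>
      norm (h u - h u' - (u - u') *\<^sub>R v) \<le> e / B * \<bar>u - u'\<bar>"
    using assms(1) \<open>e > 0\<close> B(1) unfolding strict_deriv_def by (meson divide_pos_pos)
  have "norm (L (h u - c) - L (h u' - c) - (u - u') *\<^sub>R L v) \<le> e * \<bar>u - u'\<bar>" if "\<bar>u - t\<bar> < d" "\<bar>u' - t\<bar> < d" for u u'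
  proof -
    have "norm (L (h u - c) - L (h u' - c) - (u - u') *\<^sub>R L v) = norm (L (h u - h u' - (u - u') *\<^sub>R v))"
      by (simp add: L.diff L.scaleR)
    also have "\<dots> \<le> norm (h u - h u' - (u - u') *\<^sub>R v) * B" by (rule B)
    also have "\<dots> \<le> e / B * \<bar>u - u'\<bar> * B" using d(2)[OF that] B(1) by (intro mult_right_mono) auto
    finally show ?thesis using B(1) by simp
  qed
  then show "\<exists>d>0. \<forall>u u'. \<bar>u - t\<bar> < d \<longrightarrow> \<bar>u' - t\<bar> < d \<longrightarrow>
      norm (L (h u - c) - L (h u' - c) - (u - u') *\<^sub>R L v) \<le> e * \<bar>u - u'\<bar>" using d(1) by blast
qed

text \<open>The sign -1 reverses the direction of travel and so exchanges left and right; every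
  later statement with a sign treats both sides at once this way.\<close>

lemma strict_deriv_reparam:
  assumes "strict_deriv h t v" "\<bar>\<sigma>\<bar> = 1"
  shows "strict_deriv (\<lambda>u. h (t + \<sigma> * u)) 0 (\<sigma> *\<^sub>R v)"
  unfolding strict_deriv_def
proof (intro allI impI)
  fix e :: real assume "e > 0"
  then obtain d where d: "d > 0" "\<And>u u'. \<bar>u - t\<bar> < d \<Longrightarrow> \<bar>u' - t\<bar> < d \<Longrightarrow>
      norm (h u - h u' - (u - u') *\<^sub>R v) \<le> e * \<bar>u - u'\<bar>"
    using assms(1) unfolding strict_deriv_def by meson
  have "norm (h (t + \<sigma> * u) - h (t + \<sigma> * u') - (u - u') *\<^sub>R (\<sigma> *\<^sub>R v)) \<le> e * \<bar>u - u'\<bar>"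
    if "\<bar>u - 0\<bar> < d" "\<bar>u' - 0\<bar> < d" for u u'
  proof -
    have "\<bar>\<sigma> * u - \<sigma> * u'\<bar> = \<bar>u - u'\<bar>" using assms(2) by (simp flip: right_diff_distrib add: abs_mult)
    then show ?thesis using d(2)[of "t + \<sigma> * u" "t + \<sigma> * u'"] that assms(2)
      by (simp add: abs_mult algebra_simps)
  qed
  then show "\<exists>d>0. \<forall>u u'. \<bar>u - 0\<bar> < d \<longrightarrow> \<bar>u' - 0\<bar> < d \<longrightarrow>
      norm (h (t + \<sigma> * u) - h (t + \<sigma> * u') - (u - u') *\<^sub>R (\<sigma> *\<^sub>R v)) \<le> e * \<bar>u - u'\<bar>" using d(1) by blast
qed

text \<open>Replaces constancy on the components of the complement of \<open>K\<close>. Segments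
  suffice as tests because all connecting paths below are polygonal.\<close>

definition const_on_segments :: "complex set \<Rightarrow> (complex \<Rightarrow> 'b) \<Rightarrow> bool" where
  "const_on_segments K F \<longleftrightarrow> (\<forall>x y. closed_segment x y \<inter> K = {} \<longrightarrow> F x = F y)"

lemma const_on_segmentsD:
  "const_on_segments K F \<Longrightarrow> (\<And>z. z \<in> closed_segment x y \<Longrightarrow> z \<notin> K) \<Longrightarrow> F x = F y"
  unfolding const_on_segments_def by blast

lemma closed_segment_Re_Im:
  assumes "z \<in> closed_segment x y"
  obtains l where "0 \<le> l" "l \<le> 1" "Re z = Re x + l * (Re y - Re x)" "Im z = Im x + l * (Im y - Im x)"
proof -
  obtain l where l: "0 \<le> l" "l \<le> 1" and z: "z = (1 - l) *\<^sub>R x + l *\<^sub>R y"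
    using assms by (auto simp: closed_segment_def)
  show ?thesis by (rule that[OF l]) (simp_all add: z algebra_simps)
qed

text \<open>Cone condition: near 0 the curve is a graph over its tangent, the real axis, of slope at
  most \<open>\<kappa>\<close> and traversed from left to right.\<close>

lemma strict_deriv_1_bounds:
  assumes "strict_deriv a 0 1" "0 < \<kappa>" "\<kappa> \<le> 1/2"
  obtains d where "d > 0" "\<And>u u'. \<bar>u\<bar> < d \<Longrightarrow> \<bar>u'\<bar> < d \<Longrightarrow>
      \<bar>Im (a u - a u')\<bar> \<le> \<kappa> * \<bar>Re (a u - a u')\<bar> \<and> norm (a u - a u') \<le> 2 * \<bar>u - u'\<bar>
      \<and> (u > u' \<longrightarrow> Re (a u - a u') > 0)"
proof -
  obtain d where d: "d > 0" "\<And>u u'. \<bar>u - 0\<bar> < d \<Longrightarrow> \<bar>u' - 0\<bar> < d \<Longrightarrow>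
      norm (a u - a u' - (u - u') *\<^sub>R 1) \<le> \<kappa> / 2 * \<bar>u - u'\<bar>"
    using assms unfolding strict_deriv_def by (meson half_gt_zero)
  have "\<bar>Im (a u - a u')\<bar> \<le> \<kappa> * \<bar>Re (a u - a u')\<bar> \<and> norm (a u - a u') \<le> 2 * \<bar>u - u'\<bar>
      \<and> (u > u' \<longrightarrow> Re (a u - a u') > 0)" if "\<bar>u\<bar> < d" "\<bar>u'\<bar> < d" for u u'
  proof -
    define z where "z = a u - a u'"
    define x where "x = u - u'"
    have n: "norm (z - of_real x) \<le> \<kappa> / 2 * \<bar>x\<bar>" using d(2)[of u u'] that unfolding z_def x_def by (simp add: scaleR_conv_of_real)
    have k: "\<kappa> / 2 * \<bar>x\<bar> \<le> 1/4 * \<bar>x\<bar>" using assms(3) by (intro mult_right_mono) auto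
    have i: "\<bar>Im z\<bar> \<le> \<kappa> / 2 * \<bar>x\<bar>" and r: "\<bar>Re z - x\<bar> \<le> \<kappa> / 2 * \<bar>x\<bar>"
      using n abs_Im_le_cmod[of "z - of_real x"] abs_Re_le_cmod[of "z - of_real x"] by auto
    \<comment> \<open>This loss of a factor 2 is why the derivative error was requested with
      \<open>\<kappa> / 2\<close>.\<close>
    have "\<bar>x\<bar> \<le> 2 * \<bar>Re z\<bar>" using r k by linarith
    then have "\<kappa> / 2 * \<bar>x\<bar> \<le> \<kappa> / 2 * (2 * \<bar>Re z\<bar>)" using assms(2) by (intro mult_left_mono) auto
    then have "\<bar>Im z\<bar> \<le> \<kappa> * \<bar>Re z\<bar>" using i by simp
    moreover have "norm z \<le> 2 * \<bar>x\<bar>" using n k norm_triangle_sub[of z "of_real x"] by simp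
    moreover have "Re z > 0" if "x > 0" using that r k by linarith
    ultimately show ?thesis unfolding z_def x_def by simp
  qed
  then show ?thesis using that[OF d(1)] by blast
qed

text \<open>From a point just above the graph, climb vertically to height \<open>H\<close>, then
  move horizontally to \<open>Complex 0 H\<close>. The part of \<open>K\<close> within reach is the
  graph, confined to a flat cone, so both segments avoid it. One value thus serves all nearby base
  points and all directions in the sector given by \<open>M\<close>.\<close>

lemma side_value_normalised:
  assumes F: "const_on_segments K F" and a: "strict_deriv a 0 1" "a 0 = 0"
    and loc: "\<And>d. d > 0 \<Longrightarrow> \<exists>r>0. K \<inter> ball 0 r \<subseteq> a ` {u. \<bar>u\<bar> < d}" and "M > 0"
  obtains d n where "d > 0" "\<And>u w. \<bar>u\<bar> < d \<Longrightarrow> Im w > 0 \<Longrightarrow> \<bar>Re w\<bar> \<le> M * Im w \<Longrightarrow>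
    \<forall>\<^sub>F s in at_right 0. F (a u + of_real s * w) = n \<and> a u + of_real s * w \<notin> K"
proof -
  \<comment> \<open>\<open>\<kappa> * M < 1\<close> makes every admissible direction steeper than
    the graph; \<open>\<kappa> \<le> 1/4\<close> keeps the graph well below the horizontal segment
    at height \<open>H\<close>.\<close>
  define \<kappa> where "\<kappa> = 1 / (2 * M + 4)"
  have \<kappa>: "0 < \<kappa>" "\<kappa> \<le> 1/4" "\<kappa> * M < 1" using \<open>M > 0\<close> by (auto simp: \<kappa>_def field_simps)
  obtain d0 where d0: "d0 > 0" "\<And>u u'. \<bar>u\<bar> < d0 \<Longrightarrow> \<bar>u'\<bar> < d0 \<Longrightarrow>
      \<bar>Im (a u - a u')\<bar> \<le> \<kappa> * \<bar>Re (a u - a u')\<bar> \<and> norm (a u - a u') \<le> 2 * \<bar>u - u'\<bar>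
      \<and> (u > u' \<longrightarrow> Re (a u - a u') > 0)"
    by (rule strict_deriv_1_bounds[OF a(1) \<kappa>(1)]) (use \<kappa>(2) in auto)
  obtain r where r: "r > 0" "K \<inter> ball 0 r \<subseteq> a ` {u. \<bar>u\<bar> < d0}" using loc[OF d0(1)] by blast
  define H where "H = r / 2"
  have H: "H > 0" "r = 2 * H" using r by (auto simp: H_def)
  \<comment> \<open>The bound \<open>H / 16\<close> on \<open>\<bar>u\<bar>\<close> gives
    \<open>norm (a u) < H / 8\<close>; the step along \<open>w\<close> may add another
    \<open>H / 8\<close>.\<close>
  define d where "d = min d0 (H / 16)"
  have "d > 0" using d0 H by (simp add: d_def)
  moreover have "\<forall>\<^sub>F s in at_right 0. F (a u + of_real s * w) = F (Complex 0 H) \<and> a u + of_real s * w \<notin> K"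
    if u: "\<bar>u\<bar> < d" and w: "Im w > 0" "\<bar>Re w\<bar> \<le> M * Im w" for u w
  proof -
    have ud: "\<bar>u\<bar> < d0" "norm (a u) < H / 8" using u d0(2)[of u 0] d0(1) a(2) by (auto simp: d_def)
    have pos: "0 < H / 8 / norm w" using w H by (auto intro!: divide_pos_pos)
    show ?thesis
      unfolding eventually_at_right_field
    proof (rule exI[of _ "H / 8 / norm w"], rule conjI[OF pos], intro allI impI)
      fix s assume s: "0 < s" "s < H / 8 / norm w"
      define z0 where "z0 = a u + of_real s * w"
      have "norm w > 0" using w by auto
      then have sw: "norm (of_real s * w) < H / 8" using s by (simp add: norm_mult pos_less_divide_eq)
      then have "norm z0 < H / 4" using ud norm_triangle_ineq[of "a u" "of_real s * w"] by (simp add: z0_def)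
      then have z0: "\<bar>Re z0\<bar> < H / 4" "\<bar>Im z0\<bar> < H / 4" using abs_Re_le_cmod[of z0] abs_Im_le_cmod[of z0] by auto
      have inK: "\<exists>u'. \<bar>u'\<bar> < d0 \<and> z = a u'" if "z \<in> K" "\<bar>Re z\<bar> \<le> H / 4" "\<bar>Im z\<bar> \<le> H" for z
      proof -
        have "norm z < r" using cmod_le[of z] that H by simp
        then show ?thesis using that(1) r(2) by auto
      qed
      have up: "z \<notin> K" if zs: "z \<in> closed_segment z0 (Complex (Re z0) H)" for z
      proof
        assume "z \<in> K"
        obtain l where l: "0 \<le> l" "l \<le> 1" "Re z = Re z0" "Im z = Im z0 + l * (H - Im z0)"
          by (rule closed_segment_Re_Im[OF zs]) auto
        have "0 \<le> l * (H - Im z0)" "l * (H - Im z0) \<le> H - Im z0" using l z0 by (auto intro: mult_left_le_one_le)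
        then have z: "Im z0 \<le> Im z" "Im z \<le> H" using l by auto
        then have "\<bar>Im z\<bar> \<le> H" using z0 by linarith
        then obtain u' where u': "\<bar>u'\<bar> < d0" "z = a u'" using inK[OF \<open>z \<in> K\<close>] l(3) z0(1) by auto
        have Re: "Re (a u' - a u) = s * Re w" and Im: "s * Im w \<le> Im (a u' - a u)"
          using l(3) z(1) u'(2) by (auto simp: z0_def)
        note Im
        also have "Im (a u' - a u) \<le> \<kappa> * \<bar>Re (a u' - a u)\<bar>" using d0(2)[OF u'(1) ud(1)] by linarith
        also have "\<dots> = \<kappa> * (s * \<bar>Re w\<bar>)" unfolding Re using s by (simp add: abs_mult)
        also have "\<dots> \<le> \<kappa> * (s * (M * Im w))" using \<kappa> s w by (intro mult_left_mono) auto
        also have "\<dots> = (\<kappa> * M) * (s * Im w)" by simp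
        also have "\<dots> < 1 * (s * Im w)" using \<kappa>(3) s w by (intro mult_strict_right_mono) auto
        finally show False by simp
      qed
      have across: "z \<notin> K" if zs: "z \<in> closed_segment (Complex (Re z0) H) (Complex 0 H)" for z
      proof
        assume "z \<in> K"
        obtain l where l: "0 \<le> l" "l \<le> 1" "Re z = Re z0 + l * (0 - Re z0)" "Im z = H"
          by (rule closed_segment_Re_Im[OF zs]) auto
        have "Re z = (1 - l) * Re z0" using l(3) by (simp add: algebra_simps)
        then have "\<bar>Re z\<bar> = (1 - l) * \<bar>Re z0\<bar>" using l(2) by (simp add: abs_mult)
        also have "\<dots> \<le> \<bar>Re z0\<bar>" using l by (intro mult_left_le_one_le) auto
        finally have Re: "\<bar>Re z\<bar> \<le> H / 4" using z0 by simp
        then obtain u' where u': "\<bar>u'\<bar> < d0" "z = a u'" using inK[OF \<open>z \<in> K\<close>] l H by auto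
        have "\<bar>Im z\<bar> \<le> \<kappa> * \<bar>Re z\<bar>" using d0(2)[OF u'(1), of 0] d0(1) u'(2) a(2) by simp
        also have "\<dots> \<le> 1/4 * \<bar>Re z\<bar>" using \<kappa> by (intro mult_right_mono) auto
        finally show False using l(4) Re H by simp
      qed
      have "F z0 = F (Complex 0 H)"
        using const_on_segmentsD[OF F up] const_on_segmentsD[OF F across] by simp
      moreover have "z0 \<notin> K" using up by simp
      ultimately show "F (a u + of_real s * w) = F (Complex 0 H) \<and> a u + of_real s * w \<notin> K"
        by (simp add: z0_def)
    qed
  qed
  ultimately show ?thesis by (rule that)
qed

text \<open>The strands stay in cones of slope 1/2 around the real and the imaginary axis, so the
  diagonal of the first quadrant avoids both. From a point above \<open>a u\<close>, climb
  vertically to the diagonal and follow it to \<open>Complex \<rho> \<rho>\<close>.\<close>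

lemma corner_value_normalised:
  assumes F: "const_on_segments K F" and a: "strict_deriv a 0 1" "a 0 = 0"
    and b: "strict_deriv b 0 \<i>" "b 0 = 0"
    and loc: "\<And>d. d > 0 \<Longrightarrow> \<exists>r>0. K \<inter> ball 0 r \<subseteq> a ` {u. \<bar>u\<bar> < d} \<union> b ` {u. \<bar>u\<bar> < d}"
  obtains r where "r > 0" "\<And>\<rho>. 0 < \<rho> \<Longrightarrow> \<rho> < r \<Longrightarrow> \<exists>d>0. \<forall>u. 0 < u \<longrightarrow> u < d \<longrightarrow>
    (\<forall>\<^sub>F s in at_right 0. F (a u + of_real s * \<i>) = F (Complex \<rho> \<rho>))"
proof -
  obtain d1 where d1: "d1 > 0" "\<And>u u'. \<bar>u\<bar> < d1 \<Longrightarrow> \<bar>u'\<bar> < d1 \<Longrightarrow>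
      \<bar>Im (a u - a u')\<bar> \<le> 1/2 * \<bar>Re (a u - a u')\<bar> \<and> norm (a u - a u') \<le> 2 * \<bar>u - u'\<bar>
      \<and> (u > u' \<longrightarrow> Re (a u - a u') > 0)"
    using strict_deriv_1_bounds[OF a(1), of "1/2"] by auto
  have "bounded_linear (\<lambda>z. - \<i> * z)" by (rule bounded_linear_mult_right)
  then have "strict_deriv (\<lambda>u. - \<i> * (b u - 0)) 0 (- \<i> * \<i>)" by (rule strict_deriv_linear_image[OF b(1)])
  then have "strict_deriv (\<lambda>u. - \<i> * b u) 0 1" by simp
  then obtain d2 where d2: "d2 > 0" "\<And>u u'. \<bar>u\<bar> < d2 \<Longrightarrow> \<bar>u'\<bar> < d2 \<Longrightarrow>
      \<bar>Im (- \<i> * b u - - \<i> * b u')\<bar> \<le> 1/2 * \<bar>Re (- \<i> * b u - - \<i> * b u')\<bar> \<and>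
      norm (- \<i> * b u - - \<i> * b u') \<le> 2 * \<bar>u - u'\<bar> \<and> (u > u' \<longrightarrow> Re (- \<i> * b u - - \<i> * b u') > 0)"
    by (rule strict_deriv_1_bounds[where \<kappa> = "1/2"]) auto
  have bb: "\<bar>Re (b u)\<bar> \<le> 1/2 * \<bar>Im (b u)\<bar>" if "\<bar>u\<bar> < d2" for u
    using d2(2)[OF that, of 0, THEN conjunct1] d2(1) b(2) by simp
  have aa: "\<bar>Im (a u)\<bar> \<le> 1/2 * \<bar>Re (a u)\<bar>" if "\<bar>u\<bar> < d1" for u
    using d1(2)[OF that, of 0] d1(1) a(2) by simp
  obtain r where r: "r > 0" "K \<inter> ball 0 r \<subseteq> a ` {u. \<bar>u\<bar> < min d1 d2} \<union> b ` {u. \<bar>u\<bar> < min d1 d2}"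
    using loc[of "min d1 d2"] d1(1) d2(1) by auto
  have inK: "(\<exists>u'. \<bar>u'\<bar> < d1 \<and> z = a u') \<or> (\<bar>Re z\<bar> \<le> 1/2 * \<bar>Im z\<bar>)" 
    if "z \<in> K" "\<bar>Re z\<bar> < r/4" "\<bar>Im z\<bar> < r/4" for z
  proof -
    have "norm z < r" using cmod_le[of z] that r(1) by simp
    then show ?thesis using that(1) r(2) bb by fastforce
  qed
  have "\<exists>d>0. \<forall>u. 0 < u \<longrightarrow> u < d \<longrightarrow> (\<forall>\<^sub>F s in at_right 0. F (a u + of_real s * \<i>) = F (Complex \<rho> \<rho>))"
    if \<rho>: "0 < \<rho>" "\<rho> < r/4" for \<rho>
  proof (intro exI[of _ "min d1 (r/16)"] conjI allI impI)
    show "min d1 (r / 16) > 0" using d1(1) r(1) by simp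
    fix u assume u: "0 < u" "u < min d1 (r / 16)"
    define x where "x = Re (a u)"
    have ud: "\<bar>u\<bar> < d1" using u by simp
    have x: "x > 0" "norm (a u) < r/8" using d1(2)[OF ud, of 0] d1(1) a(2) u by (auto simp: x_def)
    have xr: "x < r/4" using x complex_Re_le_cmod[of "a u"] r(1) by (simp add: x_def)
    have ima: "\<bar>Im (a u)\<bar> \<le> x/2" using aa[OF ud] x(1) by (simp add: x_def)
    show "\<forall>\<^sub>F s in at_right 0. F (a u + of_real s * \<i>) = F (Complex \<rho> \<rho>)"
      unfolding eventually_at_right_field
    proof (intro exI[of _ "x/4"] conjI allI impI)
      show "0 < x/4" using x by simp
      fix s assume s: "0 < s" "s < x/4"
      define z0 where "z0 = a u + of_real s * \<i>"
      have z0: "Re z0 = x" "Im z0 = Im (a u) + s" by (auto simp: z0_def x_def)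
      have up: "z \<notin> K" if zs: "z \<in> closed_segment z0 (Complex x x)" for z
      proof
        assume "z \<in> K"
        obtain l where l: "0 \<le> l" "l \<le> 1" "Re z = x" "Im z = Im z0 + l * (x - Im z0)"
          by (rule closed_segment_Re_Im[OF zs]) (simp add: z0(1))
        have "x - Im z0 \<ge> 0" using z0 ima s by simp
        then have "0 \<le> l * (x - Im z0)" "l * (x - Im z0) \<le> x - Im z0" using l by (auto intro: mult_left_le_one_le)
        then have z: "Im z0 \<le> Im z" "Im z \<le> x" using l by auto
        then have im: "\<bar>Im z\<bar> \<le> x" using z0 ima s x(1) by simp
        then consider u' where "\<bar>u'\<bar> < d1" "z = a u'" | "\<bar>Re z\<bar> \<le> 1/2 * \<bar>Im z\<bar>"
          using inK[OF \<open>z \<in> K\<close>] l(3) xr x(1) by auto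
        then show False
        proof cases
          case 1
          then show False using d1(2)[OF 1(1) ud] l(3) z(1) z0(2) s by (simp add: x_def)
        next
          case 2
          then show False using im l(3) x(1) by simp
        qed
      qed
      have diag: "z \<notin> K" if zs: "z \<in> closed_segment (Complex x x) (Complex \<rho> \<rho>)" for z
      proof
        assume "z \<in> K"
        obtain l where l: "0 \<le> l" "l \<le> 1" "Re z = x + l * (\<rho> - x)" "Im z = x + l * (\<rho> - x)"
          by (rule closed_segment_Re_Im[OF zs]) simp
        have e: "x + l * (\<rho> - x) = (1 - l) * x + l * \<rho>" by (simp add: algebra_simps)
        have "0 < (1 - l) * x + l * \<rho>"
          using l x \<rho> by (cases "l = 0") (auto intro: add_nonneg_pos)
        moreover have "(1 - l) * x + l * \<rho> < r/4" using l xr \<rho> convex_bound_lt[of x "r/4" \<rho> "1 - l" l] by simp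
        ultimately have z: "0 < Re z" "Re z < r/4" "Im z = Re z" using l e by auto
        then consider u' where "\<bar>u'\<bar> < d1" "z = a u'" | "\<bar>Re z\<bar> \<le> 1/2 * \<bar>Im z\<bar>"
          using inK[OF \<open>z \<in> K\<close>] by auto
        then show False
        proof cases
          case 1
          then show False using aa[OF 1(1)] z by simp
        qed (use z in auto)
      qed
      show "F (a u + of_real s * \<i>) = F (Complex \<rho> \<rho>)"
        using const_on_segmentsD[OF F up] const_on_segmentsD[OF F diag] by (simp add: z0_def)
    qed
  qed
  then show ?thesis using that[of "r/4"] r(1) by simp
qed


text \<open>Cramer's rule for the real basis \<open>v\<close>, \<open>v'\<close>.\<close>
definition basis_coord :: "complex \<Rightarrow> complex \<Rightarrow> complex \<Rightarrow> complex" where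
  "basis_coord v v' z = Complex (Im (cnj z * v') / Im (cnj v * v')) (Im (cnj v * z) / Im (cnj v * v'))"

definition basis_comb :: "complex \<Rightarrow> complex \<Rightarrow> complex \<Rightarrow> complex" where
  "basis_comb v v' z = of_real (Re z) * v + of_real (Im z) * v'"

lemma basis_comb_coord:
  assumes "Im (cnj v * v') \<noteq> 0"
  shows "basis_comb v v' (basis_coord v v' z) = z" "basis_coord v v' (basis_comb v v' z) = z"
proof -
  show "basis_comb v v' (basis_coord v v' z) = z"
  proof (rule complex_eqI)
    define D A B where "D = Im (cnj v * v')" and "A = Im (cnj z * v')" and "B = Im (cnj v * z)"
    have "basis_comb v v' (basis_coord v v' z) = of_real (A / D) * v + of_real (B / D) * v'"
      by (simp add: basis_comb_def basis_coord_def D_def A_def B_def)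
    then have e: "Re (basis_comb v v' (basis_coord v v' z)) = (A * Re v + B * Re v') / D"
      "Im (basis_comb v v' (basis_coord v v' z)) = (A * Im v + B * Im v') / D"
      by (simp_all add: add_divide_distrib)
    have "A * Re v + B * Re v' = Re z * D" "A * Im v + B * Im v' = Im z * D"
      by (simp_all add: D_def A_def B_def algebra_simps)
    then show "Re (basis_comb v v' (basis_coord v v' z)) = Re z" "Im (basis_comb v v' (basis_coord v v' z)) = Im z"
      using assms unfolding e by (simp_all add: D_def)
  qed
  show "basis_coord v v' (basis_comb v v' z) = z"
  proof (rule complex_eqI)
    have "Im (cnj (basis_comb v v' z) * v') = Re z * Im (cnj v * v')"
      "Im (cnj v * basis_comb v v' z) = Im z * Im (cnj v * v')"
      by (simp_all add: basis_comb_def algebra_simps)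
    then show "Re (basis_coord v v' (basis_comb v v' z)) = Re z" "Im (basis_coord v v' (basis_comb v v' z)) = Im z"
      using assms unfolding basis_coord_def by simp_all
  qed
qed

lemma bounded_linear_basis_coord: "bounded_linear (basis_coord v v')"
proof -
  have "linear (basis_coord v v')"
    by (rule linearI) (auto simp: basis_coord_def complex_eq_iff add_divide_distrib diff_divide_distrib algebra_simps)
  then show ?thesis by (simp add: linear_conv_bounded_linear)
qed

lemma const_on_segments_affine:
  assumes F: "const_on_segments K F" and D: "Im (cnj v * v') \<noteq> 0"
  shows "const_on_segments ((\<lambda>z. basis_coord v v' (z - c)) ` K) (\<lambda>z. F (c + basis_comb v v' z))"
  unfolding const_on_segments_def
proof (intro allI impI)
  fix x y assume d: "closed_segment x y \<inter> (\<lambda>z. basis_coord v v' (z - c)) ` K = {}"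
  have lin: "(\<lambda>z. c + basis_comb v v' z) ` closed_segment x y = closed_segment (c + basis_comb v v' x) (c + basis_comb v v' y)"
  proof -
    have "linear (basis_comb v v')" by (rule linearI) (auto simp: basis_comb_def complex_eq_iff algebra_simps)
    then have "closed_segment (basis_comb v v' x) (basis_comb v v' y) = basis_comb v v' ` closed_segment x y"
      by (rule closed_segment_linear_image)
    then show ?thesis by (metis (no_types, lifting) closed_segment_translation image_image image_cong)
  qed
  show "F (c + basis_comb v v' x) = F (c + basis_comb v v' y)"
  proof (rule const_on_segmentsD[OF F])
    fix z assume "z \<in> closed_segment (c + basis_comb v v' x) (c + basis_comb v v' y)"
    then obtain z' where z': "z' \<in> closed_segment x y" "z = c + basis_comb v v' z'" unfolding lin[symmetric] by blast
    then have "basis_coord v v' (z - c) = z'" using basis_comb_coord(2)[OF D] by simp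
    then show "z \<notin> K" using d z'(1) by blast
  qed
qed

lemma coord_image_local:
  assumes D: "Im (cnj v * v') \<noteq> 0" and "r > 0" "K \<inter> ball c r \<subseteq> U"
  shows "\<exists>r'>0. (\<lambda>z. basis_coord v v' (z - c)) ` K \<inter> ball 0 r' \<subseteq> (\<lambda>z. basis_coord v v' (z - c)) ` U"
proof -
  let ?B = "norm v + norm v'"
  have "v \<noteq> 0" using D by auto
  then have "?B > 0" by (simp add: add_pos_nonneg)
  have "norm (basis_comb v v' z) \<le> norm z * ?B" for z
  proof -
    have "norm (basis_comb v v' z) \<le> \<bar>Re z\<bar> * norm v + \<bar>Im z\<bar> * norm v'"
      unfolding basis_comb_def by (rule order_trans[OF norm_triangle_ineq]) (simp add: norm_mult)
    also have "\<dots> \<le> norm z * norm v + norm z * norm v'"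
      by (intro add_mono mult_right_mono abs_Re_le_cmod abs_Im_le_cmod) auto
    finally show ?thesis by (simp add: algebra_simps)
  qed
  note B = this
  have "(\<lambda>z. basis_coord v v' (z - c)) ` K \<inter> ball 0 (r / ?B) \<subseteq> (\<lambda>z. basis_coord v v' (z - c)) ` U"
  proof
    fix y assume "y \<in> (\<lambda>z. basis_coord v v' (z - c)) ` K \<inter> ball 0 (r / ?B)"
    then obtain z where z: "z \<in> K" "y = basis_coord v v' (z - c)" "norm y < r / ?B" by auto
    have "norm (z - c) \<le> norm y * ?B" using B[of y] z(2) basis_comb_coord(1)[OF D] by simp
    also have "\<dots> < r" using z(3) \<open>?B > 0\<close> by (simp add: pos_less_divide_eq)
    finally have "z \<in> ball c r" by (simp add: dist_norm norm_minus_commute)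
    then show "y \<in> (\<lambda>z. basis_coord v v' (z - c)) ` U" using assms(3) z by blast
  qed
  then show ?thesis using \<open>r > 0\<close> \<open>?B > 0\<close> by (intro exI[of _ "r / ?B"]) auto
qed

text \<open>With \<open>\<i> * v\<close> as second basis vector the coordinate change is division by
  \<open>v\<close>, so the left side of the curve becomes the upper half plane.\<close>

lemma side_value:
  assumes F: "const_on_segments K F" and a: "strict_deriv a 0 v" and "v \<noteq> 0"
    and loc: "\<And>d. d > 0 \<Longrightarrow> \<exists>r>0. K \<inter> ball (a 0) r \<subseteq> a ` {u. \<bar>u\<bar> < d}" and "M > 0"
  obtains d n where "d > 0" "\<And>u w. \<bar>u\<bar> < d \<Longrightarrow> Im (w / v) > 0 \<Longrightarrow> \<bar>Re (w / v)\<bar> \<le> M * Im (w / v) \<Longrightarrow>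
    \<forall>\<^sub>F s in at_right 0. F (a u + of_real s * w) = n \<and> a u + of_real s * w \<notin> K"
proof -
  let ?v' = "\<i> * v"
  let ?L = "basis_coord v ?v'" and ?T = "basis_comb v ?v'"
  have "Im (cnj v * ?v') = (norm v)\<^sup>2" unfolding cmod_power2 by (simp add: power2_eq_square)
  then have D: "Im (cnj v * ?v') \<noteq> 0" using \<open>v \<noteq> 0\<close> by simp
  have T: "?T z = z * v" for z by (simp add: basis_comb_def complex_eq_iff)
  have L: "?L z = z / v" for z using basis_comb_coord(1)[OF D, of z] \<open>v \<noteq> 0\<close> by (simp add: T field_simps)
  let ?a = "\<lambda>u. ?L (a u - a 0)" and ?K = "(\<lambda>z. ?L (z - a 0)) ` K"
  have "strict_deriv ?a 0 (?L v)" by (rule strict_deriv_linear_image[OF a bounded_linear_basis_coord])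
  then have sa: "strict_deriv ?a 0 1" using \<open>v \<noteq> 0\<close> by (simp add: L)
  have a0: "?a 0 = 0" by (simp add: L)
  have loc': "\<exists>r>0. ?K \<inter> ball 0 r \<subseteq> ?a ` {u. \<bar>u\<bar> < d}" if d: "d > 0" for d
  proof -
    obtain r where "r > 0" "K \<inter> ball (a 0) r \<subseteq> a ` {u. \<bar>u\<bar> < d}" using loc[OF d] by blast
    from coord_image_local[OF D this] show ?thesis by (simp add: image_image)
  qed
  have "\<exists>d>0. \<exists>n. \<forall>u w. \<bar>u\<bar> < d \<longrightarrow> Im w > 0 \<longrightarrow> \<bar>Re w\<bar> \<le> M * Im w \<longrightarrow>
    (\<forall>\<^sub>F s in at_right 0. F (a 0 + ?T (?a u + of_real s * w)) = n \<and> ?a u + of_real s * w \<notin> ?K)"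
  proof (rule side_value_normalised[OF const_on_segments_affine[OF F D, of "a 0"] sa a0 loc' \<open>M > 0\<close>])
    fix d n assume *: "d > 0" "\<And>u w. \<bar>u\<bar> < d \<Longrightarrow> Im w > 0 \<Longrightarrow> \<bar>Re w\<bar> \<le> M * Im w \<Longrightarrow>
      \<forall>\<^sub>F s in at_right 0. F (a 0 + ?T (?a u + of_real s * w)) = n \<and> ?a u + of_real s * w \<notin> ?K"
    show ?thesis
      by (rule exI[of _ d], rule conjI[OF *(1)], rule exI[of _ n], intro allI impI, rule *(2))
  qed
  then obtain d n where nd: "d > 0" "\<forall>u w. \<bar>u\<bar> < d \<longrightarrow> Im w > 0 \<longrightarrow> \<bar>Re w\<bar> \<le> M * Im w \<longrightarrow>
    (\<forall>\<^sub>F s in at_right 0. F (a 0 + ?T (?a u + of_real s * w)) = n \<and> ?a u + of_real s * w \<notin> ?K)"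
    by (elim exE conjE)
  show ?thesis
  proof (rule that[OF nd(1)])
    fix u w assume "\<bar>u\<bar> < d" "Im (w / v) > 0" "\<bar>Re (w / v)\<bar> \<le> M * Im (w / v)"
    from nd(2)[rule_format, OF this]
    show "\<forall>\<^sub>F s in at_right 0. F (a u + of_real s * w) = n \<and> a u + of_real s * w \<notin> K"
    proof (rule eventually_mono)
      fix s assume *: "F (a 0 + ?T (?a u + of_real s * (w / v))) = n \<and> ?a u + of_real s * (w / v) \<notin> ?K"
      have "a 0 + ?T (?a u + of_real s * (w / v)) = a u + of_real s * w"
        "?a u + of_real s * (w / v) = ?L (a u + of_real s * w - a 0)"
        using \<open>v \<noteq> 0\<close> by (simp_all add: T L field_simps)
      then show "F (a u + of_real s * w) = n \<and> a u + of_real s * w \<notin> K" using * by force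
    qed
  qed
qed

text \<open>In the basis \<open>v\<close>, \<open>v'\<close> the sector spanned by the two tangents
  is the first quadrant. The basis may have either orientation, so the result can be applied a
  second time with the strands exchanged.\<close>

lemma corner_value:
  assumes F: "const_on_segments K F" and a: "strict_deriv a 0 v" and b: "strict_deriv b 0 v'" and "a 0 = b 0"
    and D: "Im (cnj v * v') \<noteq> 0"
    and loc: "\<And>d. d > 0 \<Longrightarrow> \<exists>r>0. K \<inter> ball (a 0) r \<subseteq> a ` {u. \<bar>u\<bar> < d} \<union> b ` {u. \<bar>u\<bar> < d}"
  obtains r where "r > 0" "\<And>\<rho>. 0 < \<rho> \<Longrightarrow> \<rho> < r \<Longrightarrow> \<exists>d>0. \<forall>u. 0 < u \<longrightarrow> u < d \<longrightarrow>
    (\<forall>\<^sub>F s in at_right 0. F (a u + of_real s * v') = F (a 0 + of_real \<rho> * (v + v')))"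
proof -
  let ?L = "basis_coord v v'" and ?T = "basis_comb v v'"
  let ?a = "\<lambda>u. ?L (a u - a 0)" and ?b = "\<lambda>u. ?L (b u - a 0)" and ?K = "(\<lambda>z. ?L (z - a 0)) ` K"
  have L: "?L v = 1" "?L v' = \<i>" "?L 0 = 0" using D by (auto simp: basis_coord_def complex_eq_iff)
  have sa: "strict_deriv ?a 0 1" "strict_deriv ?b 0 \<i>"
    using strict_deriv_linear_image[OF a bounded_linear_basis_coord] strict_deriv_linear_image[OF b bounded_linear_basis_coord] L
    by metis+
  have a0: "?a 0 = 0" "?b 0 = 0" using \<open>a 0 = b 0\<close> L by auto
  have loc': "\<exists>r>0. ?K \<inter> ball 0 r \<subseteq> ?a ` {u. \<bar>u\<bar> < d} \<union> ?b ` {u. \<bar>u\<bar> < d}" if d: "d > 0" for d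
  proof -
    obtain r where "r > 0" "K \<inter> ball (a 0) r \<subseteq> a ` {u. \<bar>u\<bar> < d} \<union> b ` {u. \<bar>u\<bar> < d}" using loc[OF d] by blast
    from coord_image_local[OF D this] show ?thesis by (simp add: image_image image_Un)
  qed
  have "\<exists>r>0. \<forall>\<rho>. 0 < \<rho> \<longrightarrow> \<rho> < r \<longrightarrow> (\<exists>d>0. \<forall>u. 0 < u \<longrightarrow> u < d \<longrightarrow>
    (\<forall>\<^sub>F s in at_right 0. F (a 0 + ?T (?a u + of_real s * \<i>)) = F (a 0 + ?T (Complex \<rho> \<rho>))))"
  proof (rule corner_value_normalised[OF const_on_segments_affine[OF F D, of "a 0"] sa(1) a0(1) sa(2) a0(2) loc'])
    fix r assume *: "r > 0" "\<And>\<rho>. 0 < \<rho> \<Longrightarrow> \<rho> < r \<Longrightarrow> \<exists>d>0. \<forall>u. 0 < u \<longrightarrow> u < d \<longrightarrow>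
      (\<forall>\<^sub>F s in at_right 0. F (a 0 + ?T (?a u + of_real s * \<i>)) = F (a 0 + ?T (Complex \<rho> \<rho>)))"
    show ?thesis by (rule exI[of _ r], rule conjI[OF *(1)], intro allI impI, rule *(2))
  qed
  then obtain r where r: "r > 0" "\<forall>\<rho>. 0 < \<rho> \<longrightarrow> \<rho> < r \<longrightarrow> (\<exists>d>0. \<forall>u. 0 < u \<longrightarrow> u < d \<longrightarrow>
    (\<forall>\<^sub>F s in at_right 0. F (a 0 + ?T (?a u + of_real s * \<i>)) = F (a 0 + ?T (Complex \<rho> \<rho>))))"
    by (elim exE conjE)
  have add: "?T (x + y) = ?T x + ?T y" for x y by (simp add: basis_comb_def algebra_simps)
  have e: "a 0 + ?T (?a u + of_real s * \<i>) = a u + of_real s * v'" for u s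
    unfolding add basis_comb_coord(1)[OF D] by (simp add: basis_comb_def)
  have e': "?T (Complex \<rho> \<rho>) = of_real \<rho> * (v + v')" for \<rho> by (simp add: basis_comb_def algebra_simps)
  show ?thesis by (rule that[OF r(1)], rule r(2)[unfolded e e', rule_format])
qed

section \<open>Immersed plane loops\<close>

lemma periodic_of_int:
  assumes "\<And>t. g (t + 1) = g (t::real)"
  shows "g (t + of_int n) = g t"
proof -
  have nat: "g (t + of_nat k) = g t" for t k
  proof (induction k)
    case (Suc k)
    then show ?case using assms[of "t + of_nat k"] by (simp add: algebra_simps)
  qed simp
  show ?thesis
  proof (cases n rule: int_cases2)
    case (nonpos k)
    then show ?thesis using nat[of "t - of_nat k" k] by simp
  qed (simp add: nat)
qed

lemma vector_derivative_periodic: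
  assumes per: "\<And>t. g (t + 1) = g (t::real)" and diff: "\<And>t. g differentiable at t"
  shows "vector_derivative g (at (t + 1)) = vector_derivative g (at t)"
proof -
  have "(g has_vector_derivative vector_derivative g (at (t + 1))) (at (t + 1))"
    using diff by (simp add: vector_derivative_works)
  then have "((\<lambda>s. g (s + 1)) has_vector_derivative 1 *\<^sub>R vector_derivative g (at (t + 1))) (at t)"
    using vector_diff_chain_at[of "\<lambda>s. s + 1" 1 t g] by (simp add: has_vector_derivative_add_const o_def)
  then show ?thesis by (simp add: per vector_derivative_at)
qed

lemma frac_of_periodic: "(\<And>t. g (t + 1) = g (t::real)) \<Longrightarrow> g (frac t) = g t"
  using periodic_of_int[of g t "- \<lfloor>t\<rfloor>"] by (simp add: frac_def)

lemma frac_eq_iff: "frac s = frac t \<longleftrightarrow> s - t \<in> \<int>"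
proof
  assume "frac s = frac t"
  then have "s - t = of_int (\<lfloor>s\<rfloor> - \<lfloor>t\<rfloor>)" by (simp add: frac_def)
  then show "s - t \<in> \<int>" by (metis Ints_of_int)
next
  assume "s - t \<in> \<int>"
  then obtain k where "s = t + of_int k" by (metis Ints_cases add.commute diff_add_cancel)
  then show "frac s = frac t" by (simp add: frac_def)
qed

text \<open>Parameters are reals, and \<open>s - t \<notin> \<int>\<close> says that they differ on
  the circle. \<open>Im (cnj x * y)\<close> is the determinant of two plane vectors; its sign later
  decides between left and right.\<close>

locale immersed_loop =
  fixes h h' :: "real \<Rightarrow> complex"
  assumes periodic: "\<And>t. h (t + 1) = h t"
    and deriv: "\<And>t. (h has_vector_derivative h' t) (at t)"
    and cont: "continuous_on UNIV h'"
    and nonzero: "\<And>t. h' t \<noteq> 0"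
    and transverse: "\<And>s t. h s = h t \<Longrightarrow> s - t \<notin> \<int> \<Longrightarrow> Im (cnj (h' t) * h' s) \<noteq> 0"
    and no_triple: "\<And>s t u. h s = h t \<Longrightarrow> h u = h t \<Longrightarrow> s - t \<notin> \<int> \<Longrightarrow> u - t \<notin> \<int> \<Longrightarrow> s - u \<in> \<int>"
begin

lemma isCont_h': "isCont h' t"
  using cont by (simp add: continuous_on_eq_continuous_at)

lemma continuous_h: "continuous_on S h"
  using deriv by (meson continuous_at_imp_continuous_on has_vector_derivative_continuous)

lemma strict: "strict_deriv h t (h' t)"
  by (rule strict_derivI[OF deriv isCont_h'])

lemma periodic_int: "h (t + of_int n) = h t"
  by (rule periodic_of_int[of h, OF periodic])

lemma h'_eq: "h' = (\<lambda>t. vector_derivative h (at t))"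
  by (rule ext) (rule vector_derivative_at[OF deriv, symmetric])

lemma periodic_deriv: "h' (t + 1) = h' t"
  unfolding h'_eq using deriv
  by (intro vector_derivative_periodic periodic differentiableI_vector)

section \<open>The loop near one of its points and the values on its two sides\<close>

definition simple_param :: "real \<Rightarrow> bool" where
  "simple_param t \<longleftrightarrow> (\<forall>s. h s = h t \<longrightarrow> s - t \<in> \<int>)"

text \<open>Compactness: the parameters at distance at least \<open>d\<close> from \<open>B\<close>
  modulo 1 have a compact image that misses \<open>c\<close>, hence misses a ball around
  \<open>c\<close>.\<close>

lemma image_near_point:
  assumes fib: "\<And>s. h s = c \<Longrightarrow> \<exists>b\<in>B. s - b \<in> \<int>" and "d > 0"
  shows "\<exists>r>0. range h \<inter> ball c r \<subseteq> (\<Union>b\<in>B. h ` {u. \<bar>u - b\<bar> < d})"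
proof -
  define U where "U = (\<Union>b\<in>B. \<Union>n::int. ball (b + of_int n) d)"
  have "open U" unfolding U_def by auto
  then have "compact ({0..1} - U)" by (simp add: compact_diff)
  then have "closed (h ` ({0..1} - U))" by (intro compact_imp_closed compact_continuous_image continuous_h)
  moreover have "c \<notin> h ` ({0..1} - U)"
  proof
    assume "c \<in> h ` ({0..1} - U)"
    then obtain s where s: "h s = c" "s \<notin> U" by auto
    then obtain b where b: "b \<in> B" "s - b \<in> \<int>" using fib by blast
    then obtain n where "s = b + of_int n" by (metis Ints_cases add.commute diff_add_cancel)
    then have "s \<in> U" unfolding U_def using b(1) \<open>d > 0\<close> by (intro UN_I[of b] UN_I[of n]) auto
    then show False using s by blast
  qed
  ultimately obtain r where r: "r > 0" "ball c r \<subseteq> - h ` ({0..1} - U)"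
    by (meson ComplI open_Compl open_contains_ball)
  have "range h \<inter> ball c r \<subseteq> (\<Union>b\<in>B. h ` {u. \<bar>u - b\<bar> < d})"
  proof
    fix z assume z: "z \<in> range h \<inter> ball c r"
    then obtain s where s: "z = h s" by blast
    have "h (frac s) = z" using frac_of_periodic[of h, OF periodic] s by simp
    moreover have "frac s \<in> {0..1}" using frac_ge_0[of s] frac_lt_1[of s] by auto
    ultimately have "frac s \<in> U" using r(2) z by blast
    then obtain b n where b: "b \<in> B" "dist (b + of_int n) (frac s) < d" unfolding U_def by auto
    have "h (frac s + of_int (- n)) = z" using periodic_int[of "frac s" "- n"] \<open>h (frac s) = z\<close> by simp
    moreover have "\<bar>frac s + of_int (- n) - b\<bar> < d" using b(2) by (simp add: dist_real_def)
    ultimately show "z \<in> (\<Union>b\<in>B. h ` {u. \<bar>u - b\<bar> < d})" using b(1) by blast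
  qed
  then show ?thesis using r(1) by blast
qed

lemma image_reparam:
  assumes "\<bar>\<sigma>\<bar> = 1"
  shows "h ` {u. \<bar>u - t\<bar> < d} = (\<lambda>u. h (t + \<sigma> * u)) ` {u. \<bar>u\<bar> < d}"
proof -
  have ss: "\<sigma> * \<sigma> = 1" using assms by (metis abs_mult_self_eq mult_1)
  have "{u. \<bar>u - t\<bar> < d} = (\<lambda>u. t + \<sigma> * u) ` {u. \<bar>u\<bar> < d}"
  proof (intro set_eqI iffI)
    fix x assume x: "x \<in> {u. \<bar>u - t\<bar> < d}"
    have "x = t + \<sigma> * (\<sigma> * (x - t))" using ss by (simp flip: mult.assoc)
    moreover have "\<bar>\<sigma> * (x - t)\<bar> < d" using x assms by (simp add: abs_mult)
    ultimately show "x \<in> (\<lambda>u. t + \<sigma> * u) ` {u. \<bar>u\<bar> < d}" by blast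
  qed (use assms in \<open>auto simp: abs_mult\<close>)
  then show ?thesis by (simp add: image_image)
qed

text \<open>The sign 1 gives the left side and -1 the right, approached along the normal. Leaving
  the curve is part of the definition because winding numbers are integers only off the
  loop.\<close>

definition left_value :: "(complex \<Rightarrow> 'b) \<Rightarrow> real \<Rightarrow> real \<Rightarrow> 'b \<Rightarrow> bool" where
  "left_value F t \<sigma> n \<longleftrightarrow> (\<forall>\<^sub>F s in at_right 0. F (h t + of_real s * (of_real \<sigma> * \<i> * h' t)) = n \<and>
     h t + of_real s * (of_real \<sigma> * \<i> * h' t) \<notin> range h)"

lemma left_value_unique: "left_value F t \<sigma> n \<Longrightarrow> left_value F t \<sigma> m \<Longrightarrow> n = m"
proof -
  assume "left_value F t \<sigma> n" "left_value F t \<sigma> m"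
  then have "\<forall>\<^sub>F s in at_right (0::real). n = m" unfolding left_value_def by eventually_elim auto
  then show ?thesis by simp
qed

lemma side_value_simple:
  assumes F: "const_on_segments (range h) F" and t: "simple_param t" and \<sigma>: "\<bar>\<sigma>\<bar> = 1" and "M > 0"
  obtains d n where "d > 0" "\<And>t' w. \<bar>t' - t\<bar> < d \<Longrightarrow> Im (w / (\<sigma> *\<^sub>R h' t)) > 0 \<Longrightarrow>
    \<bar>Re (w / (\<sigma> *\<^sub>R h' t))\<bar> \<le> M * Im (w / (\<sigma> *\<^sub>R h' t)) \<Longrightarrow>
    \<forall>\<^sub>F s in at_right 0. F (h t' + of_real s * w) = n \<and> h t' + of_real s * w \<notin> range h"
proof -
  let ?a = "\<lambda>u. h (t + \<sigma> * u)"
  have loc: "\<exists>r>0. range h \<inter> ball (?a 0) r \<subseteq> ?a ` {u. \<bar>u\<bar> < d}" if "d > 0" for d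
    using image_near_point[of "h t" "{t}" d] t that image_reparam[OF \<sigma>] by (simp add: simple_param_def)
  have nz: "\<sigma> *\<^sub>R h' t \<noteq> 0" using nonzero[of t] \<sigma> by auto
  have ss: "\<sigma> * \<sigma> = 1" using \<sigma> by (metis abs_mult_self_eq mult_1)
  show ?thesis
  proof (rule side_value[OF F strict_deriv_reparam[OF strict \<sigma>] nz loc \<open>M > 0\<close>])
    fix d n assume d: "d > 0" and *: "\<And>u w. \<bar>u\<bar> < d \<Longrightarrow> Im (w / (\<sigma> *\<^sub>R h' t)) > 0 \<Longrightarrow>
      \<bar>Re (w / (\<sigma> *\<^sub>R h' t))\<bar> \<le> M * Im (w / (\<sigma> *\<^sub>R h' t)) \<Longrightarrow>
      \<forall>\<^sub>F s in at_right 0. F (?a u + of_real s * w) = n \<and> ?a u + of_real s * w \<notin> range h"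
    show thesis
    proof (rule that[OF d])
      fix t' w assume t': "\<bar>t' - t\<bar> < d" and w: "Im (w / (\<sigma> *\<^sub>R h' t)) > 0"
        "\<bar>Re (w / (\<sigma> *\<^sub>R h' t))\<bar> \<le> M * Im (w / (\<sigma> *\<^sub>R h' t))"
      have "?a (\<sigma> * (t' - t)) = h t'" using ss by (simp flip: mult.assoc)
      moreover have "\<bar>\<sigma> * (t' - t)\<bar> < d" using t' \<sigma> by (simp add: abs_mult)
      ultimately show "\<forall>\<^sub>F s in at_right 0. F (h t' + of_real s * w) = n \<and> h t' + of_real s * w \<notin> range h"
        using *[of "\<sigma> * (t' - t)" w] w by simp
    qed
  qed
qed

text \<open>The quotient \<open>h' t' / h' t\<close> stays within 1/2 of 1, so the normals at nearby
  parameters lie in the sector with \<open>M = 1\<close> around the normal at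
  \<open>t\<close>.\<close>

lemma left_value_near:
  assumes F: "const_on_segments (range h) F" and t: "simple_param t" and \<sigma>: "\<bar>\<sigma>\<bar> = 1"
  obtains d n where "d > 0" "\<And>t'. \<bar>t' - t\<bar> < d \<Longrightarrow> left_value F t' \<sigma> n"
proof -
  have "isCont (\<lambda>s. h' s / h' t) t" using isCont_h' nonzero by (intro continuous_intros) auto
  moreover have "h' t / h' t = 1" using nonzero by simp
  ultimately obtain d1 where d1: "d1 > 0" "\<And>s. \<bar>s - t\<bar> < d1 \<Longrightarrow> norm (h' s / h' t - 1) < 1/2"
    unfolding continuous_at_eps_delta dist_norm by (metis half_gt_zero zero_less_one real_norm_def)
  show ?thesis
  proof (rule side_value_simple[OF F t \<sigma> zero_less_one])
    fix d n assume d: "d > 0" and *: "\<And>t' w. \<bar>t' - t\<bar> < d \<Longrightarrow> Im (w / (\<sigma> *\<^sub>R h' t)) > 0 \<Longrightarrow>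
      \<bar>Re (w / (\<sigma> *\<^sub>R h' t))\<bar> \<le> 1 * Im (w / (\<sigma> *\<^sub>R h' t)) \<Longrightarrow>
      \<forall>\<^sub>F s in at_right 0. F (h t' + of_real s * w) = n \<and> h t' + of_real s * w \<notin> range h"
    show thesis
    proof (rule that[of "min d d1" n])
      fix t' assume t': "\<bar>t' - t\<bar> < min d d1"
      define q where "q = h' t' / h' t"
      have "norm (q - 1) < 1/2" using d1(2)[of t'] t' by (simp add: q_def)
      then have q: "Re q > 1/2" "\<bar>Im q\<bar> < 1/2" using abs_Re_le_cmod[of "q - 1"] abs_Im_le_cmod[of "q - 1"] by auto
      have "\<sigma> \<noteq> 0" using \<sigma> by auto
      then have e: "of_real \<sigma> * \<i> * h' t' / (\<sigma> *\<^sub>R h' t) = \<i> * q" by (simp add: q_def scaleR_conv_of_real)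
      show "left_value F t' \<sigma> n" unfolding left_value_def
        by (rule *) (use t' q in \<open>auto simp: e\<close>)
    qed (use d d1 in auto)
  qed
qed

text \<open>\<open>M\<close> is taken large enough for the sector around the normal to contain
  \<open>w\<close>. At a crossing, \<open>w\<close> will be a tangent of the other strand.\<close>

lemma left_value_direction:
  assumes F: "const_on_segments (range h) F" and t: "simple_param t" and \<sigma>: "\<bar>\<sigma>\<bar> = 1"
    and n: "left_value F t \<sigma> n" and w: "Im (cnj (\<sigma> *\<^sub>R h' t) * w) > 0"
  shows "\<forall>\<^sub>F s in at_right 0. F (h t + of_real s * w) = n"
proof -
  define v where "v = \<sigma> *\<^sub>R h' t"
  have "v \<noteq> 0" using nonzero[of t] \<sigma> by (auto simp: v_def)
  have "Im (w / v) = Im (cnj v * w) / (norm v)\<^sup>2"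
    unfolding cmod_power2 Im_divide by (simp add: algebra_simps)
  then have pos: "Im (w / v) > 0" using w \<open>v \<noteq> 0\<close> by (simp add: v_def)
  define M where "M = 1 + \<bar>Re (w / v)\<bar> / Im (w / v)"
  have M: "M > 0" "\<bar>Re (w / v)\<bar> \<le> M * Im (w / v)" using pos by (auto simp: M_def field_simps add_pos_nonneg)
  have e: "of_real \<sigma> * \<i> * h' t / v = \<i>" using \<open>v \<noteq> 0\<close> by (simp add: v_def scaleR_conv_of_real)
  show ?thesis
  proof (rule side_value_simple[OF F t \<sigma> M(1)])
    fix d m assume d: "d > 0" and *: "\<And>t' w. \<bar>t' - t\<bar> < d \<Longrightarrow> Im (w / (\<sigma> *\<^sub>R h' t)) > 0 \<Longrightarrow>
      \<bar>Re (w / (\<sigma> *\<^sub>R h' t))\<bar> \<le> M * Im (w / (\<sigma> *\<^sub>R h' t)) \<Longrightarrow>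
      \<forall>\<^sub>F s in at_right 0. F (h t' + of_real s * w) = m \<and> h t' + of_real s * w \<notin> range h"
    have "left_value F t \<sigma> m" unfolding left_value_def
      by (rule *) (use d M(1) e in \<open>auto simp: v_def\<close>)
    then have "m = n" by (rule left_value_unique[OF _ n])
    moreover have "\<forall>\<^sub>F s in at_right 0. F (h t + of_real s * w) = m \<and> h t + of_real s * w \<notin> range h"
      by (rule *) (use d pos M(2) in \<open>auto simp: v_def\<close>)
    ultimately show ?thesis by (auto elim: eventually_mono)
  qed
qed

text \<open>Meaningful only where the one-sided value exists, in particular at simple parameters.\<close>
definition side :: "(complex \<Rightarrow> 'b) \<Rightarrow> real \<Rightarrow> real \<Rightarrow> 'b" where
  "side F t \<sigma> = (THE n. left_value F t \<sigma> n)"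

lemma side_eqI: "left_value F t \<sigma> n \<Longrightarrow> side F t \<sigma> = n"
  unfolding side_def by (rule the_equality, assumption, erule left_value_unique)

lemma left_value_side:
  assumes "const_on_segments (range h) F" "simple_param t" "\<bar>\<sigma>\<bar> = 1"
  shows "left_value F t \<sigma> (side F t \<sigma>)"
proof (rule left_value_near[OF assms])
  fix d n assume "d > 0" "\<And>t'. \<bar>t' - t\<bar> < d \<Longrightarrow> left_value F t' \<sigma> n"
  then have "left_value F t \<sigma> n" by simp
  with side_eqI[OF this] show ?thesis by simp
qed

lemma side_periodic: "side F (t + 1) \<sigma> = side F t \<sigma>"
  unfolding side_def left_value_def by (simp add: periodic periodic_deriv)

lemma side_const_interval:
  assumes F: "const_on_segments (range h) F" and \<sigma>: "\<bar>\<sigma>\<bar> = 1"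
    and simple: "\<And>t. p < t \<Longrightarrow> t < q \<Longrightarrow> simple_param t"
    and t: "p < t" "t < q" "p < t'" "t' < q"
  shows "side F t \<sigma> = side F t' \<sigma>"
proof -
  have "(\<lambda>t. side F t \<sigma>) constant_on {p<..<q}"
  proof (rule locally_constant_imp_constant)
    fix a assume a: "a \<in> {p<..<q}"
    then have "simple_param a" using simple by auto
    show "\<exists>T. openin (top_of_set {p<..<q}) T \<and> a \<in> T \<and> (\<forall>x\<in>T. side F x \<sigma> = side F a \<sigma>)"
    proof (rule left_value_near[OF F \<open>simple_param a\<close> \<sigma>])
      fix d n assume d: "d > 0" and *: "\<And>t'. \<bar>t' - a\<bar> < d \<Longrightarrow> left_value F t' \<sigma> n"
      show ?thesis
      proof (rule exI[of _ "{p<..<q} \<inter> ball a d"], intro conjI ballI)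
        show "openin (top_of_set {p<..<q}) ({p<..<q} \<inter> ball a d)" by (rule openin_open_Int) simp
        show "a \<in> {p<..<q} \<inter> ball a d" using a d by simp
        fix x assume "x \<in> {p<..<q} \<inter> ball a d"
        then have "\<bar>x - a\<bar> < d" by (auto simp: dist_real_def)
        then show "side F x \<sigma> = side F a \<sigma>"
          using side_eqI[OF *[of x]] side_eqI[OF *[of a]] d by simp
      qed
    qed
  qed simp
  then show ?thesis using t unfolding constant_on_def by auto
qed

lemma positive_near:
  assumes "Im (cnj (\<sigma> *\<^sub>R h' t) * w) > 0"
  shows "\<exists>d>0. \<forall>t'. \<bar>t' - t\<bar> < d \<longrightarrow> Im (cnj (\<sigma> *\<^sub>R h' t') * w) > 0"
proof -
  have "continuous_on UNIV (\<lambda>t. Im (cnj (\<sigma> *\<^sub>R h' t) * w))" by (intro continuous_intros cont)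
  then have "isCont (\<lambda>t. Im (cnj (\<sigma> *\<^sub>R h' t) * w)) t" by (simp add: continuous_on_eq_continuous_at)
  then have "\<forall>\<^sub>F t' in at t. Im (cnj (\<sigma> *\<^sub>R h' t') * w) > 0"
    using assms order_tendstoD(1) unfolding isCont_def by blast
  then obtain d where "d > 0" "\<And>t'. t' \<noteq> t \<Longrightarrow> dist t' t < d \<Longrightarrow> Im (cnj (\<sigma> *\<^sub>R h' t') * w) > 0"
    unfolding eventually_at by auto
  then show ?thesis using assms by (metis dist_real_def)
qed

text \<open>Arrive along strand \<open>t\<close> and turn left into strand \<open>s\<close>. The
  sides before and after the turn both face the sector spanned by the backward tangent
  \<open>v\<close> and the outgoing tangent \<open>v'\<close>, and both values equal that of
  \<open>F\<close> at one point \<open>h t + \<rho> (v + v')\<close>.\<close>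

lemma side_corner:
  assumes F: "const_on_segments (range h) F" and st: "h s = h t" "s - t \<notin> \<int>"
    and \<sigma>: "\<bar>\<sigma>\<bar> = 1" "\<bar>\<sigma>'\<bar> = 1" and pos: "Im (cnj (\<sigma> *\<^sub>R h' t) * (\<sigma>' *\<^sub>R h' s)) > 0"
    and e: "e > 0" "\<And>u. 0 < u \<Longrightarrow> u < e \<Longrightarrow> simple_param (t - \<sigma> * u)" "\<And>u. 0 < u \<Longrightarrow> u < e \<Longrightarrow> simple_param (s + \<sigma>' * u)"
  shows "\<exists>d>0. \<forall>u u'. 0 < u \<longrightarrow> u < d \<longrightarrow> 0 < u' \<longrightarrow> u' < d \<longrightarrow> side F (t - \<sigma> * u) \<sigma> = side F (s + \<sigma>' * u') \<sigma>'"
proof -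
  define v v' where "v = (- \<sigma>) *\<^sub>R h' t" and "v' = \<sigma>' *\<^sub>R h' s"
  let ?a = "\<lambda>u. h (t + (- \<sigma>) * u)" and ?b = "\<lambda>u. h (s + \<sigma>' * u)"
  have m\<sigma>: "\<bar>- \<sigma>\<bar> = 1" using \<sigma> by simp
  have a: "strict_deriv ?a 0 v" "strict_deriv ?b 0 v'" unfolding v_def v'_def
    by (rule strict_deriv_reparam[OF strict m\<sigma>], rule strict_deriv_reparam[OF strict \<sigma>(2)])
  have ab: "?a 0 = ?b 0" using st by simp
  have D: "Im (cnj v * v') \<noteq> 0" "Im (cnj v' * v) \<noteq> 0" using pos by (auto simp: v_def v'_def algebra_simps)
  have loc: "\<exists>r>0. range h \<inter> ball (h t) r \<subseteq> ?a ` {u. \<bar>u\<bar> < d} \<union> ?b ` {u. \<bar>u\<bar> < d}" if "d > 0" for d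
  proof -
    have "\<exists>b\<in>{t, s}. x - b \<in> \<int>" if "h x = h t" for x
      using no_triple[of s t x] st that by (metis Ints_minus insertI1 insertI2 minus_diff_eq singletonI)
    then have "\<exists>r>0. range h \<inter> ball (h t) r \<subseteq> (\<Union>b\<in>{t, s}. h ` {u. \<bar>u - b\<bar> < d})"
      by (rule image_near_point[OF _ \<open>d > 0\<close>])
    then show ?thesis
      by (simp only: UN_insert UN_empty Un_empty_right image_reparam[OF m\<sigma>, of t] image_reparam[OF \<sigma>(2), of s])
  qed
  have loca: "\<exists>r>0. range h \<inter> ball (?a 0) r \<subseteq> ?a ` {u. \<bar>u\<bar> < d} \<union> ?b ` {u. \<bar>u\<bar> < d}" if "d > 0" for d
    using loc[OF that] by simp
  have locb: "\<exists>r>0. range h \<inter> ball (?b 0) r \<subseteq> ?b ` {u. \<bar>u\<bar> < d} \<union> ?a ` {u. \<bar>u\<bar> < d}" if "d > 0" for d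
    using loc[OF that] st by (simp add: Un_commute)
  have "\<exists>r>0. \<forall>\<rho>. 0 < \<rho> \<longrightarrow> \<rho> < r \<longrightarrow> (\<exists>d>0. \<forall>u. 0 < u \<longrightarrow> u < d \<longrightarrow>
    (\<forall>\<^sub>F x in at_right 0. F (?a u + of_real x * v') = F (h t + of_real \<rho> * (v + v'))))"
    by (rule corner_value[OF F a ab D(1) loca]) auto
  then obtain r1 where r1: "r1 > 0" "\<And>\<rho>. 0 < \<rho> \<Longrightarrow> \<rho> < r1 \<Longrightarrow> \<exists>d>0. \<forall>u. 0 < u \<longrightarrow> u < d \<longrightarrow>
    (\<forall>\<^sub>F x in at_right 0. F (?a u + of_real x * v') = F (h t + of_real \<rho> * (v + v')))" by metis
  have "\<exists>r>0. \<forall>\<rho>. 0 < \<rho> \<longrightarrow> \<rho> < r \<longrightarrow> (\<exists>d>0. \<forall>u. 0 < u \<longrightarrow> u < d \<longrightarrow>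
    (\<forall>\<^sub>F x in at_right 0. F (?b u + of_real x * v) = F (h t + of_real \<rho> * (v + v'))))"
    by (rule corner_value[OF F a(2,1) ab[symmetric] D(2) locb]) (auto simp: st add.commute[of v' v])
  then obtain r2 where r2: "r2 > 0" "\<And>\<rho>. 0 < \<rho> \<Longrightarrow> \<rho> < r2 \<Longrightarrow> \<exists>d>0. \<forall>u. 0 < u \<longrightarrow> u < d \<longrightarrow>
    (\<forall>\<^sub>F x in at_right 0. F (?b u + of_real x * v) = F (h t + of_real \<rho> * (v + v')))" by metis
  define \<rho> where "\<rho> = min r1 r2 / 2"
  have \<rho>: "0 < \<rho>" "\<rho> < r1" "\<rho> < r2" using r1(1) r2(1) by (auto simp: \<rho>_def min_def)
  let ?N = "F (h t + of_real \<rho> * (v + v'))"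
  obtain d1 where d1: "d1 > 0" "\<And>u. 0 < u \<Longrightarrow> u < d1 \<Longrightarrow> \<forall>\<^sub>F x in at_right 0. F (?a u + of_real x * v') = ?N"
    using r1(2)[OF \<rho>(1,2)] by blast
  obtain d2 where d2: "d2 > 0" "\<And>u. 0 < u \<Longrightarrow> u < d2 \<Longrightarrow> \<forall>\<^sub>F x in at_right 0. F (?b u + of_real x * v) = ?N"
    using r2(2)[OF \<rho>(1,3)] by blast
  obtain d3 where d3: "d3 > 0" "\<And>t'. \<bar>t' - t\<bar> < d3 \<Longrightarrow> Im (cnj (\<sigma> *\<^sub>R h' t') * v') > 0"
    using positive_near[of \<sigma> t v'] pos by (auto simp: v'_def)
  have "Im (cnj (\<sigma>' *\<^sub>R h' s) * v) > 0" using pos by (simp add: v_def algebra_simps)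
  then obtain d4 where d4: "d4 > 0" "\<And>t'. \<bar>t' - s\<bar> < d4 \<Longrightarrow> Im (cnj (\<sigma>' *\<^sub>R h' t') * v) > 0"
    using positive_near[of \<sigma>' s v] by blast
  define d where "d = min (min d1 d2) (min e (min d3 d4))"
  have "d > 0" using d1 d2 d3 d4 e by (simp add: d_def)
  have A: "side F (t - \<sigma> * u) \<sigma> = ?N" if u: "0 < u" "u < d" for u
  proof -
    have sp: "simple_param (t - \<sigma> * u)" using e(2) u by (simp add: d_def)
    have "\<bar>(t - \<sigma> * u) - t\<bar> < d3" using u \<sigma> by (simp add: abs_mult d_def)
    from left_value_direction[OF F sp \<sigma>(1) left_value_side[OF F sp \<sigma>(1)] d3(2)[OF this]]
    have "\<forall>\<^sub>F x in at_right 0. F (h (t - \<sigma> * u) + of_real x * v') = side F (t - \<sigma> * u) \<sigma>" .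
    moreover have "\<forall>\<^sub>F x in at_right 0. F (h (t - \<sigma> * u) + of_real x * v') = ?N"
      using d1(2)[of u] u by (simp add: d_def)
    ultimately have "\<forall>\<^sub>F x in at_right (0::real). side F (t - \<sigma> * u) \<sigma> = ?N" by eventually_elim simp
    then show ?thesis by simp
  qed
  have B: "side F (s + \<sigma>' * u) \<sigma>' = ?N" if u: "0 < u" "u < d" for u
  proof -
    have sp: "simple_param (s + \<sigma>' * u)" using e(3) u by (simp add: d_def)
    have "\<bar>(s + \<sigma>' * u) - s\<bar> < d4" using u \<sigma> by (simp add: abs_mult d_def)
    from left_value_direction[OF F sp \<sigma>(2) left_value_side[OF F sp \<sigma>(2)] d4(2)[OF this]]
    have "\<forall>\<^sub>F x in at_right 0. F (h (s + \<sigma>' * u) + of_real x * v) = side F (s + \<sigma>' * u) \<sigma>'" .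
    moreover have "\<forall>\<^sub>F x in at_right 0. F (h (s + \<sigma>' * u) + of_real x * v) = ?N"
      using d2(2)[of u] u by (simp add: d_def)
    ultimately have "\<forall>\<^sub>F x in at_right (0::real). side F (s + \<sigma>' * u) \<sigma>' = ?N" by eventually_elim simp
    then show ?thesis by simp
  qed
  show ?thesis using \<open>d > 0\<close> A B by (intro exI[of _ d]) auto
qed

end

section \<open>Winding numbers on the two sides of an arc\<close>

context immersed_loop
begin

lemma valid_path_subpath_h: "valid_path (subpath p q h)"
proof -
  have "subpath p q h C1_differentiable_on {0..1}"
    unfolding C1_differentiable_on_def
  proof (intro exI conjI ballI)
    fix x :: real
    have "((\<lambda>x. (q - p) * x + p) has_vector_derivative (q - p)) (at x)"
      by (auto intro!: derivative_eq_intros simp flip: has_real_derivative_iff_has_vector_derivative)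
    from vector_diff_chain_at[OF this deriv]
    show "(subpath p q h has_vector_derivative (q - p) *\<^sub>R h' ((q - p) * x + p)) (at x)"
      by (simp add: o_def subpath_def)
    show "continuous_on {0..1} (\<lambda>x. (q - p) *\<^sub>R h' ((q - p) * x + p))"
      by (intro continuous_intros continuous_on_compose2[OF cont]) auto
  qed
  then show ?thesis by (simp add: valid_path_def C1_differentiable_imp_piecewise)
qed

lemma path_image_subpath_h: "p \<le> q \<Longrightarrow> path_image (subpath p q h) = h ` {p..q}"
  by (rule path_image_subpath_gen[THEN trans]) (simp add: closed_segment_eq_real_ivl)

lemma subpath_subpath: "subpath x y (subpath p q h) = subpath (p + (q - p) * x) (p + (q - p) * y) h"
  by (rule ext) (simp add: subpath_def algebra_simps)

text \<open>Along an arc that misses the ray from \<open>z\<close> in direction \<open>\<zeta> i v\<close>, the winding number around \<open>z\<close>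
  is given by the branch of the logarithm cut along that ray.\<close>
lemma winding_number_arc_Ln:
  assumes "p \<le> q" "v \<noteq> 0" "\<zeta> \<noteq> 0"
    and cut: "\<And>s. s \<in> {p..q} \<Longrightarrow> \<zeta> * \<i> * (h s - z) / v \<notin> \<real>\<^sub>\<le>\<^sub>0"
  shows "winding_number (subpath p q h) z =
    (Ln (\<zeta> * \<i> * (h q - z) / v) - Ln (\<zeta> * \<i> * (h p - z) / v)) / (2 * of_real pi * \<i>)"
proof -
  let ?S = "{w. \<zeta> * \<i> * (w - z) / v \<notin> \<real>\<^sub>\<le>\<^sub>0}" and ?f = "\<lambda>w. Ln (\<zeta> * \<i> * (w - z) / v)"
  have "((\<lambda>w. 1 / (w - z)) has_contour_integral (?f (pathfinish (subpath p q h)) - ?f (pathstart (subpath p q h)))) (subpath p q h)"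
  proof (rule contour_integral_primitive[of ?S])
    fix w assume w: "w \<in> ?S"
    then have "\<zeta> * \<i> * (w - z) / v \<noteq> 0" by auto
    then have "w \<noteq> z" by auto
    have "((\<lambda>w. \<zeta> * \<i> * (w - z) / v) has_field_derivative \<zeta> * \<i> / v) (at w within ?S)"
      using \<open>v \<noteq> 0\<close> by (auto intro!: derivative_eq_intros)
    from DERIV_chain2[OF has_field_derivative_Ln this] w
    have "(?f has_field_derivative inverse (\<zeta> * \<i> * (w - z) / v) * (\<zeta> * \<i> / v)) (at w within ?S)" by simp
    moreover have "inverse (\<zeta> * \<i> * (w - z) / v) * (\<zeta> * \<i> / v) = 1 / (w - z)"
      using \<open>w \<noteq> z\<close> assms(2,3) by (simp add: divide_simps)
    ultimately show "(?f has_field_derivative 1 / (w - z)) (at w within ?S)" by simp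
  next
    show "path_image (subpath p q h) \<subseteq> ?S" using cut path_image_subpath_h[OF \<open>p \<le> q\<close>] by auto
  qed (rule valid_path_subpath_h)
  moreover have "z \<notin> path_image (subpath p q h)"
  proof
    assume "z \<in> path_image (subpath p q h)"
    then obtain s where "s \<in> {p..q}" "z = h s" using path_image_subpath_h[OF \<open>p \<le> q\<close>] by auto
    then show False using cut[of s] by simp
  qed
  ultimately show ?thesis
    using winding_number_valid_path[OF valid_path_subpath_h] contour_integral_unique
    by (simp add: pathfinish_subpath pathstart_subpath)
qed

lemma tendsto_ray: "((\<lambda>s. c + of_real s * w) \<longlongrightarrow> (c::complex)) (at_right 0)"
  by (rule tendsto_eq_intros | simp)+

text \<open>Negating the argument shifts \<open>Ln\<close> by \<open>- pi * \<i>\<close> in the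
  upper half plane and by \<open>pi * \<i>\<close> in the lower. The points \<open>\<i> * q2\<close>
  and \<open>\<i> * q1\<close> lie in these two half planes, so the shifts add up.\<close>

lemma Ln_branch_jump:
  assumes "Re q1 < 0" "Re q2 > 0"
  shows "(Ln (\<i> * q2) - Ln (\<i> * q1)) - (Ln (- \<i> * q2) - Ln (- \<i> * q1)) = 2 * of_real pi * \<i>"
proof -
  have "\<i> * q1 \<noteq> 0" "\<i> * q2 \<noteq> 0" using assms by auto
  from Ln_minus[OF this(1)] Ln_minus[OF this(2)] show ?thesis using assms by simp
qed

end

section \<open>The winding number of the loop based at a crossing\<close>

locale immersed_loop_chord = immersed_loop +
  fixes \<alpha> \<beta> :: real
  assumes chord: "\<alpha> < \<beta>" "\<beta> < \<alpha> + 1" "h \<alpha> = h \<beta>"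
begin

abbreviation "W \<equiv> winding_number (subpath \<alpha> \<beta> h)"

lemma loop_facts: "path (subpath \<alpha> \<beta> h)" "pathfinish (subpath \<alpha> \<beta> h) = pathstart (subpath \<alpha> \<beta> h)"
  "path_image (subpath \<alpha> \<beta> h) = h ` {\<alpha>..\<beta>}"
  using chord valid_path_subpath_h path_image_subpath_h
  by (auto simp: valid_path_imp_path pathfinish_subpath pathstart_subpath)

lemma const_on_segments_W: "const_on_segments (range h) W"
  unfolding const_on_segments_def
proof (intro allI impI)
  fix x y assume "closed_segment x y \<inter> range h = {}"
  then have "closed_segment x y \<inter> path_image (subpath \<alpha> \<beta> h) = {}" using loop_facts(3) by auto
  then show "W x = W y" using loop_facts(1,2) by (intro winding_number_eq[of _ _ "closed_segment x y"]) auto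
qed

lemma side_W_Ints:
  assumes "simple_param t" "\<bar>\<sigma>\<bar> = 1"
  shows "side W t \<sigma> \<in> \<int>"
proof -
  have "\<forall>\<^sub>F s in at_right (0::real). side W t \<sigma> \<in> \<int>"
    using left_value_side[OF const_on_segments_W assms] unfolding left_value_def
  proof (rule eventually_mono)
    fix s assume *: "W (h t + of_real s * (of_real \<sigma> * \<i> * h' t)) = side W t \<sigma> \<and>
      h t + of_real s * (of_real \<sigma> * \<i> * h' t) \<notin> range h"
    then have "h t + of_real s * (of_real \<sigma> * \<i> * h' t) \<notin> path_image (subpath \<alpha> \<beta> h)" using loop_facts(3) by blast
    from integer_winding_number[OF loop_facts(1,2) this] * show "side W t \<sigma> \<in> \<int>" by simp
  qed
  then show ?thesis by simp
qed

lemma side_W_limit: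
  assumes "simple_param t" "\<bar>\<sigma>\<bar> = 1"
    and lim: "((\<lambda>s. W (h t + of_real s * (of_real \<sigma> * \<i> * h' t))) \<longlongrightarrow> l) (at_right 0)"
  shows "side W t \<sigma> = l"
proof -
  have "\<forall>\<^sub>F s in at_right 0. W (h t + of_real s * (of_real \<sigma> * \<i> * h' t)) = side W t \<sigma>"
    using left_value_side[OF const_on_segments_W assms(1,2)] unfolding left_value_def by (rule eventually_mono) auto
  then have "((\<lambda>s. W (h t + of_real s * (of_real \<sigma> * \<i> * h' t))) \<longlongrightarrow> side W t \<sigma>) (at_right 0)"
    by (rule tendsto_eventually)
  then show ?thesis using lim tendsto_unique by (metis trivial_limit_at_right_real)
qed

text \<open>The point \<open>h t\<close> is off the loop, so \<open>W\<close> is continuous there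
  and both sides have the same limit.\<close>

lemma side_W_outside:
  assumes t: "simple_param t" and out: "\<And>s. \<alpha> \<le> s \<Longrightarrow> s \<le> \<beta> \<Longrightarrow> s - t \<notin> \<int>"
  shows "side W t 1 = side W t (- 1)"
proof -
  have "h t \<notin> path_image (subpath \<alpha> \<beta> h)"
    using out t unfolding loop_facts(3) simple_param_def by force
  then have "isCont W (h t)" by (rule continuous_at_winding_number[OF loop_facts(1)])
  then have "((\<lambda>s. W (h t + of_real s * (of_real \<sigma> * \<i> * h' t))) \<longlongrightarrow> W (h t)) (at_right 0)" for \<sigma> :: real
    by (rule isCont_tendsto_compose[OF _ tendsto_ray])
  then have "side W t \<sigma> = W (h t)" if "\<bar>\<sigma>\<bar> = 1" for \<sigma> by (rule side_W_limit[OF t that])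
  from this[of 1] this[of "- 1"] show ?thesis by simp
qed

text \<open>Split the loop into a short arc through \<open>t\<close> and the rest. The rest,
  \<open>R\<close>, is continuous at \<open>h t\<close> and contributes equally to both sides. For
  the arc, a logarithm cut along a ray pointing away from it gives the limit on each side, and the
  two branches differ by one full turn.\<close>

lemma side_W_inside:
  assumes t: "simple_param t" and "\<alpha> < t" "t < \<beta>"
  shows "side W t 1 - side W t (- 1) = 1"
proof -
  define c v where "c = h t" and "v = h' t"
  have "v \<noteq> 0" using nonzero by (simp add: v_def)
  define a where "a = (\<lambda>u. (h (t + u) - c) / v)"
  have "strict_deriv (\<lambda>u. h (t + 1 * u)) 0 (1 *\<^sub>R v)" unfolding v_def
    by (rule strict_deriv_reparam[OF strict]) simp
  then have "strict_deriv (\<lambda>u. h (t + u)) 0 v" by simp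
  from strict_deriv_linear_image[OF this bounded_linear_divide[of v], of c] \<open>v \<noteq> 0\<close>
  have "strict_deriv a 0 1" by (simp add: a_def)
  then obtain d where d: "d > 0" "\<And>u u'. \<bar>u\<bar> < d \<Longrightarrow> \<bar>u'\<bar> < d \<Longrightarrow>
      \<bar>Im (a u - a u')\<bar> \<le> 1/2 * \<bar>Re (a u - a u')\<bar> \<and> norm (a u - a u') \<le> 2 * \<bar>u - u'\<bar>
      \<and> (u > u' \<longrightarrow> Re (a u - a u') > 0)"
    by (rule strict_deriv_1_bounds[where \<kappa> = "1/2"]) auto
  have a0: "a 0 = 0" by (simp add: a_def c_def)
  have Re_a: "Re (a u) > 0" if "0 < u" "u < d" for u using d(2)[of u 0] that a0 by simp
  have Re_a': "Re (a u) < 0" if "u < 0" "- d < u" for u using d(2)[of 0 u] that a0 by simp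
  define \<delta> where "\<delta> = min (d / 2) (min ((t - \<alpha>) / 2) ((\<beta> - t) / 2))"
  have \<delta>: "0 < \<delta>" "\<delta> < d" "\<alpha> < t - \<delta>" "t + \<delta> < \<beta>"
    using d(1) assms(2,3) by (auto simp: \<delta>_def min_def field_simps)
  define q1 q2 where "q1 = a (- \<delta>)" and "q2 = a \<delta>"
  have q: "Re q1 < 0" "Re q2 > 0" using Re_a Re_a' \<delta> by (auto simp: q1_def q2_def)
  define R where "R = (\<lambda>z. winding_number (subpath \<alpha> (t - \<delta>) h) z + winding_number (subpath (t + \<delta>) \<beta> h) z)"
  have "c \<notin> h ` {\<alpha>..t - \<delta>} \<union> h ` {t + \<delta>..\<beta>}"
  proof
    assume "c \<in> h ` {\<alpha>..t - \<delta>} \<union> h ` {t + \<delta>..\<beta>}"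
    then obtain s where s: "h s = h t" "\<alpha> \<le> s" "s \<le> \<beta>" "s \<noteq> t" using \<delta> by (auto simp: c_def)
    then have "s - t \<in> \<int>" "\<bar>s - t\<bar> < 1" using t chord assms(2,3) by (auto simp: simple_param_def)
    then show False using s(4) Ints_nonzero_abs_ge1[of "s - t"] by simp
  qed
  then have "isCont R c" unfolding R_def
    using \<delta> path_image_subpath_h[of \<alpha> "t - \<delta>"] path_image_subpath_h[of "t + \<delta>" \<beta>]
    by (intro continuous_intros continuous_at_winding_number valid_path_imp_path valid_path_subpath_h) auto
  have W_split: "W z = R z + winding_number (subpath (t - \<delta>) (t + \<delta>) h) z" if z: "z \<notin> range h" for z
  proof -
    define x1 x2 where "x1 = (t - \<delta> - \<alpha>) / (\<beta> - \<alpha>)" and "x2 = (t + \<delta> - \<alpha>) / (\<beta> - \<alpha>)"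
    have x: "x1 \<in> {0..1}" "x2 \<in> {0..1}" using \<delta> chord by (auto simp: x1_def x2_def field_simps)
    have e: "\<alpha> + (\<beta> - \<alpha>) * x1 = t - \<delta>" "\<alpha> + (\<beta> - \<alpha>) * x2 = t + \<delta>" using chord by (auto simp: x1_def x2_def)
    have z': "z \<notin> path_image (subpath \<alpha> \<beta> h)" using z loop_facts(3) by auto
    note comb = winding_number_subpath_combine[OF loop_facts(1) z']
    have "winding_number (subpath 0 x1 (subpath \<alpha> \<beta> h)) z + winding_number (subpath x1 x2 (subpath \<alpha> \<beta> h)) z
      = winding_number (subpath 0 x2 (subpath \<alpha> \<beta> h)) z" using x by (intro comb) auto
    moreover have "winding_number (subpath 0 x2 (subpath \<alpha> \<beta> h)) z + winding_number (subpath x2 1 (subpath \<alpha> \<beta> h)) z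
      = winding_number (subpath 0 1 (subpath \<alpha> \<beta> h)) z" using x by (intro comb) auto
    ultimately have "winding_number (subpath \<alpha> (t - \<delta>) h) z + winding_number (subpath (t - \<delta>) (t + \<delta>) h) z
      + winding_number (subpath (t + \<delta>) \<beta> h) z = W z" unfolding subpath_subpath e by simp
    from this[symmetric] show ?thesis unfolding R_def by simp
  qed
  define m where "m = (\<lambda>\<zeta>::complex. (Ln (\<zeta> * \<i> * q2) - Ln (\<zeta> * \<i> * q1)) / (2 * of_real pi * \<i>))"
  have lim: "side W t \<sigma> = R c + m (of_real \<sigma>)" if \<sigma>: "\<bar>\<sigma>\<bar> = 1" for \<sigma>
  proof (rule side_W_limit[OF t \<sigma>])
    let ?z = "\<lambda>s::real. h t + of_real s * (of_real \<sigma> * \<i> * h' t)"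
    have "\<sigma> * \<sigma> = 1" using \<sigma> by (metis abs_mult_self_eq mult_1)
    then have ss: "of_real \<sigma> * of_real \<sigma> = (1::complex)" by (metis of_real_1 of_real_mult)
    have key: "of_real \<sigma> * \<i> * (h (t + u) - ?z s) / v = of_real \<sigma> * \<i> * a u + of_real s" for u s
    proof -
      have "(h (t + u) - ?z s) / v = a u - of_real s * (of_real \<sigma> * \<i>)"
        using \<open>v \<noteq> 0\<close> by (simp add: a_def c_def v_def field_simps)
      then have "of_real \<sigma> * \<i> * (h (t + u) - ?z s) / v = of_real \<sigma> * \<i> * (a u - of_real s * (of_real \<sigma> * \<i>))"
        by (simp only: times_divide_eq_right[symmetric])
      also have "\<dots> = of_real \<sigma> * \<i> * a u + (of_real \<sigma> * of_real \<sigma>) * of_real s" by (simp add: algebra_simps)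
      finally show ?thesis by (simp add: ss)
    qed
    have mid: "winding_number (subpath (t - \<delta>) (t + \<delta>) h) (?z s) =
      (Ln (of_real \<sigma> * \<i> * q2 + of_real s) - Ln (of_real \<sigma> * \<i> * q1 + of_real s)) / (2 * of_real pi * \<i>)" if "s > 0" for s
    proof -
      \<comment> \<open>After division by \<open>v\<close> the imaginary part is
        \<open>\<sigma> * Re (a u)\<close>, which vanishes only at \<open>u = 0\<close>, where the
        value is \<open>s > 0\<close>.\<close>
      have cut: "of_real \<sigma> * \<i> * (h s' - ?z s) / v \<notin> \<real>\<^sub>\<le>\<^sub>0" if s': "s' \<in> {t - \<delta>..t + \<delta>}" for s'
      proof -
        define u where "u = s' - t"
        have u: "\<bar>u\<bar> < d" "s' = t + u" using s' \<delta>(2) by (auto simp: u_def)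
        have "of_real \<sigma> * \<i> * a u + of_real s \<notin> \<real>\<^sub>\<le>\<^sub>0"
        proof (cases "u = 0")
          case True
          then show ?thesis using \<open>s > 0\<close> a0 by (simp add: complex_nonpos_Reals_iff)
        next
          case False
          then have "Re (a u) \<noteq> 0" using Re_a[of u] Re_a'[of u] u by force
          then show ?thesis using \<sigma> by (auto simp: complex_nonpos_Reals_iff)
        qed
        then show ?thesis using key[of u s] u(2) by simp
      qed
      have "of_real \<sigma> \<noteq> (0::complex)" using \<sigma> by auto
      from winding_number_arc_Ln[OF _ \<open>v \<noteq> 0\<close> this cut] \<delta>(1) show ?thesis
        using key[of \<delta> s] key[of "- \<delta>" s] by (simp add: q1_def q2_def)
    qed
    \<comment> \<open>The arc's end points stay off the cut in the limit \<open>s = 0\<close> too,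
      so \<open>Ln\<close> is continuous there.\<close>
    have nonpos: "of_real \<sigma> * \<i> * q2 \<notin> \<real>\<^sub>\<le>\<^sub>0" "of_real \<sigma> * \<i> * q1 \<notin> \<real>\<^sub>\<le>\<^sub>0"
      using q \<sigma> by (auto simp: complex_nonpos_Reals_iff)
    have "((\<lambda>s. (Ln (of_real \<sigma> * \<i> * q2 + of_real s * 1) - Ln (of_real \<sigma> * \<i> * q1 + of_real s * 1)) / (2 * of_real pi * \<i>))
      \<longlongrightarrow> m (of_real \<sigma>)) (at_right 0)"
      unfolding m_def by (intro tendsto_intros tendsto_Ln tendsto_ray nonpos) auto
    moreover have "((\<lambda>s. R (?z s)) \<longlongrightarrow> R c) (at_right 0)"
      using \<open>isCont R c\<close> unfolding c_def by (rule isCont_tendsto_compose[OF _ tendsto_ray])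
    ultimately have "((\<lambda>s. R (?z s) + (Ln (of_real \<sigma> * \<i> * q2 + of_real s * 1) - Ln (of_real \<sigma> * \<i> * q1 + of_real s * 1)) / (2 * of_real pi * \<i>))
      \<longlongrightarrow> R c + m (of_real \<sigma>)) (at_right 0)" by (intro tendsto_add)
    moreover have "\<forall>\<^sub>F s in at_right 0. R (?z s) + (Ln (of_real \<sigma> * \<i> * q2 + of_real s * 1) - Ln (of_real \<sigma> * \<i> * q1 + of_real s * 1)) / (2 * of_real pi * \<i>)
      = W (?z s)"
    proof -
      have "\<forall>\<^sub>F s in at_right 0. ?z s \<notin> range h"
        using left_value_side[OF const_on_segments_W t \<sigma>] unfolding left_value_def by (rule eventually_mono) auto
      moreover have "\<forall>\<^sub>F s in at_right (0::real). s > 0" by (simp add: eventually_at_right_less)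
      ultimately show ?thesis by eventually_elim (simp add: W_split mid)
    qed
    ultimately show "((\<lambda>s. W (?z s)) \<longlongrightarrow> R c + m (of_real \<sigma>)) (at_right 0)"
      by (rule Lim_transform_eventually)
  qed
  have "side W t 1 - side W t (- 1) = m 1 - m (- 1)" using lim[of 1] lim[of "- 1"] by simp
  also have "\<dots> = ((Ln (\<i> * q2) - Ln (\<i> * q1)) - (Ln (- \<i> * q2) - Ln (- \<i> * q1))) / (2 * of_real pi * \<i>)"
    by (simp add: m_def diff_divide_distrib)
  also have "\<dots> = 1" unfolding Ln_branch_jump[OF q] by simp
  finally show ?thesis .
qed

end

section \<open>The Gauss word of an immersed plane loop\<close>

text \<open>Labels are abstract because the word is studied on the plane loop \<open>h\<close>,
  while its letters remain points of the sphere.\<close>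

locale gauss_loop = immersed_loop +
  fixes ts :: "real list" and label :: "real \<Rightarrow> 'a"
  assumes sorted: "sorted_wrt (<) ts" and nonempty_ts: "ts \<noteq> []"
    and set_ts: "set ts = {t \<in> {0..<1}. \<exists>s\<in>{0..<1}. s \<noteq> t \<and> h s = h t}"
    and label: "\<And>s t. s \<in> {0..<1} \<Longrightarrow> t \<in> {0..<1} \<Longrightarrow> label s = label t \<longleftrightarrow> h s = h t"
begin

abbreviation "n \<equiv> length ts"
abbreviation "w \<equiv> map label ts"

lemma T_mono: "i < j \<Longrightarrow> j < n \<Longrightarrow> ts ! i < ts ! j"
  using sorted by (simp add: sorted_wrt_nth_less)

lemma T_range: "k < n \<Longrightarrow> 0 \<le> ts ! k \<and> ts ! k < 1"
  using nth_mem[of k ts] unfolding set_ts by simp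

lemma T_inj: "i < n \<Longrightarrow> j < n \<Longrightarrow> ts ! i = ts ! j \<Longrightarrow> i = j"
  using T_mono by (metis less_irrefl linorder_neqE_nat)

lemma unit_interval_diff_Ints: "s \<in> {0..<1} \<Longrightarrow> t \<in> {0..<1} \<Longrightarrow> s - t \<in> \<int> \<Longrightarrow> s = (t::real)"
  using Ints_nonzero_abs_ge1[of "s - t"] by (cases "s = t") auto

lemma ex_partner:
  assumes "k < n" shows "\<exists>j<n. j \<noteq> k \<and> h (ts ! j) = h (ts ! k)"
proof -
  have "ts ! k \<in> set ts" using assms by simp
  then obtain s where s: "s \<in> {0..<1}" "s \<noteq> ts ! k" "h s = h (ts ! k)" "ts ! k \<in> {0..<1}" unfolding set_ts by auto
  then have "s \<in> set ts" unfolding set_ts by (metis (mono_tags, lifting) mem_Collect_eq)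
  then show ?thesis using s by (metis in_set_conv_nth)
qed

definition partner_of :: "nat \<Rightarrow> nat" where
  "partner_of k = (SOME j. j < n \<and> j \<noteq> k \<and> h (ts ! j) = h (ts ! k))"

lemma partner_of: 
  assumes "k < n" 
  shows "partner_of k < n" "partner_of k \<noteq> k" "h (ts ! partner_of k) = h (ts ! k)"
  using someI_ex[OF ex_partner[OF assms]] unfolding partner_of_def by auto

lemma T_diff_Ints: "i < n \<Longrightarrow> j < n \<Longrightarrow> i \<noteq> j \<Longrightarrow> ts ! i - ts ! j \<notin> \<int>"
  using unit_interval_diff_Ints[of "ts ! i" "ts ! j"] T_range T_inj by auto

lemma same_point:
  assumes "k < n" "j < n" "h (ts ! j) = h (ts ! k)" shows "j = k \<or> j = partner_of k"
proof (rule ccontr)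
  assume n: "\<not> (j = k \<or> j = partner_of k)"
  then have "ts ! j - ts ! partner_of k \<in> \<int>"
    using no_triple[OF assms(3) partner_of(3)[OF assms(1)]] T_diff_Ints partner_of[OF assms(1)] assms by auto
  then show False using T_diff_Ints[of j "partner_of k"] partner_of[OF assms(1)] assms n by auto
qed

lemma w_nth_eq: "i < n \<Longrightarrow> j < n \<Longrightarrow> w ! i = w ! j \<longleftrightarrow> h (ts ! i) = h (ts ! j)"
  using label[of "ts ! i" "ts ! j"] T_range by simp

lemma positions_w: "k < n \<Longrightarrow> {j. j < n \<and> w ! j = w ! k} = {k, partner_of k}"
  using same_point[of k] partner_of[of k] w_nth_eq by blast

lemma double_word_w: "double_word w"
  unfolding double_word_def
proof
  fix x assume "x \<in> set w"
  then obtain k where k: "k < n" "w ! k = x" by (metis in_set_conv_nth length_map)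
  then show "count_list w x = 2"
    using positions_w[OF k(1)] partner_of[OF k(1)] card_positions[of w x] by simp
qed

section \<open>Edges between consecutive crossings and values to the left of darts\<close>

definition edge_end :: "nat \<Rightarrow> real" where
  "edge_end k = (if Suc k = n then ts ! 0 + 1 else ts ! Suc k)"

lemma n_pos: "0 < n" using nonempty_ts by simp

lemma edge_end_gt: "k < n \<Longrightarrow> ts ! k < edge_end k"
  using T_mono[of k "Suc k"] T_range[of k] T_range[OF n_pos] by (auto simp: edge_end_def)

text \<open>The fractional part of a double parameter is an entry of \<open>ts\<close>, but none
  lies strictly between consecutive entries. The last edge is treated apart because its parameters
  may pass 1.\<close>

lemma simple_param_edge:
  assumes k: "k < n" and t: "ts ! k < t" "t < edge_end k"
  shows "simple_param t"
  unfolding simple_param_def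
proof (intro allI impI, rule ccontr)
  fix s assume s: "h s = h t" "s - t \<notin> \<int>"
  have "frac s \<noteq> frac t" using s(2) frac_eq_iff by blast
  then have "frac t \<in> set ts" unfolding set_ts using frac_of_periodic[of h, OF periodic] s(1) frac_ge_0 frac_lt_1
    by (intro CollectI conjI bexI[of _ "frac s"]) auto
  then obtain m where m: "m < n" "ts ! m = frac t" by (metis in_set_conv_nth)
  have T0: "0 \<le> ts ! k" "ts ! k < 1" using T_range k by auto
  show False
  proof (cases "t < 1")
    case True
    then have "frac t = t" using t T0 by (simp add: frac_eq)
    then have "k < m" using m t k by (metis T_mono less_asym linorder_neqE_nat less_irrefl)
    then have "Suc k \<noteq> n" "ts ! Suc k \<le> ts ! m" using m T_mono[of "Suc k" m] by (auto simp: le_less Suc_lessI dest: Suc_lessI)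
    then show False using t(2) m \<open>frac t = t\<close> by (simp add: edge_end_def)
  next
    case False
    have last: "Suc k = n"
    proof (rule ccontr)
      assume "Suc k \<noteq> n"
      then have "edge_end k < 1" using T_range[of "Suc k"] k by (simp add: edge_end_def)
      then show False using t False by simp
    qed
    then have "t < ts ! 0 + 1" using t by (simp add: edge_end_def)
    moreover from this have "frac t = t - 1" using False T_range[OF n_pos] by (simp add: frac_unique_iff)
    moreover have "ts ! 0 \<le> ts ! m" using T_mono[of 0 m] m by (cases m) auto
    ultimately show False using m by simp
  qed
qed

lemma simple_param_periodic: "simple_param (t + 1) \<longleftrightarrow> simple_param t"
proof -
  have "s - (t + 1) \<in> \<int> \<longleftrightarrow> s - t \<in> \<int>" for s
    using Ints_add[of "s - (t + 1)" 1] Ints_diff[of "s - t" 1] by (auto simp: algebra_simps)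
  then show ?thesis unfolding simple_param_def periodic by simp
qed

definition dir :: "bool \<Rightarrow> real" where "dir d = (if d then 1 else - 1)"

lemma abs_dir: "\<bar>dir d\<bar> = 1" by (simp add: dir_def)

text \<open>The value of \<open>F\<close> immediately to the left of a dart.\<close>
definition dart_value :: "(complex \<Rightarrow> 'b) \<Rightarrow> nat \<times> bool \<Rightarrow> 'b" where
  "dart_value F x = (let k = if snd x then fst x else cyc_pred n (fst x)
     in side F ((ts ! k + edge_end k) / 2) (dir (snd x)))"

lemma side_edge:
  assumes F: "const_on_segments (range h) F" and k: "k < n" "ts ! k < t" "t < edge_end k" and "\<bar>\<sigma>\<bar> = 1"
  shows "side F t \<sigma> = side F ((ts ! k + edge_end k) / 2) \<sigma>"
  using simple_param_edge[OF k(1)] edge_end_gt[OF k(1)] k(2,3)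
  by (intro side_const_interval[OF F \<open>\<bar>\<sigma>\<bar> = 1\<close>, of "ts ! k" "edge_end k"]) auto

lemma near_position:
  assumes k: "k < n"
  shows "\<exists>e>0. \<forall>u. 0 < u \<longrightarrow> u < e \<longrightarrow> simple_param (ts ! k + u) \<and> simple_param (ts ! k - u) \<and>
    (\<forall>F \<sigma>. const_on_segments (range h) (F :: complex \<Rightarrow> 'b) \<longrightarrow> \<bar>\<sigma>\<bar> = 1 \<longrightarrow>
      side F (ts ! k + u) \<sigma> = side F ((ts ! k + edge_end k) / 2) \<sigma> \<and>
      side F (ts ! k - u) \<sigma> = side F ((ts ! cyc_pred n k + edge_end (cyc_pred n k)) / 2) \<sigma>)"
proof -
  let ?j = "cyc_pred n k"
  have j: "?j < n" using k by (rule cyc_less)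
  define e where "e = min (edge_end k - ts ! k) (edge_end ?j - ts ! ?j)"
  have "e > 0" using edge_end_gt[OF k] edge_end_gt[OF j] by (simp add: e_def)
  moreover have "simple_param (ts ! k + u) \<and> simple_param (ts ! k - u) \<and>
    (\<forall>F \<sigma>. const_on_segments (range h) (F :: complex \<Rightarrow> 'b) \<longrightarrow> \<bar>\<sigma>\<bar> = 1 \<longrightarrow>
      side F (ts ! k + u) \<sigma> = side F ((ts ! k + edge_end k) / 2) \<sigma> \<and>
      side F (ts ! k - u) \<sigma> = side F ((ts ! ?j + edge_end ?j) / 2) \<sigma>)" if u: "0 < u" "u < e" for u
  proof -
    have up: "ts ! k < ts ! k + u" "ts ! k + u < edge_end k" using u by (auto simp: e_def)
    \<comment> \<open>Just before position 0 the parameter lies on the last edge, one period too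
      early; adding 1 brings it into range.\<close>
    define t where "t = (if k = 0 then ts ! k - u + 1 else ts ! k - u)"
    have "edge_end ?j = (if k = 0 then ts ! k + 1 else ts ! k)" using k by (auto simp: cyc_pred_def edge_end_def)
    then have t: "ts ! ?j < t" "t < edge_end ?j" using u by (auto simp: t_def e_def)
    have "simple_param (ts ! k - u)" using simple_param_edge[OF j t] simple_param_periodic by (auto simp: t_def split: if_splits)
    moreover have "side F (ts ! k - u) \<sigma> = side F t \<sigma>" for F :: "complex \<Rightarrow> 'b" and \<sigma>
      using side_periodic[of F "ts ! k - u" \<sigma>] by (auto simp: t_def)
    ultimately show ?thesis using simple_param_edge[OF k up] side_edge[OF _ k up] side_edge[OF _ j t] by auto
  qed
  ultimately show ?thesis by blast
qed

text \<open>Positive determinant: the partner strand crosses from right to left. This is the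
  \<open>\<epsilon>\<close> of the boundary walk.\<close>

definition crossing_sign :: "nat \<Rightarrow> bool" where
  "crossing_sign k \<longleftrightarrow> Im (cnj (h' (ts ! k)) * h' (ts ! partner_of k)) > 0"

text \<open>The walk takes a left turn in the sense of \<open>side_corner\<close>: choosing
  \<open>d'\<close> by the crossing sign makes the determinant of the arriving and leaving
  directions positive.\<close>

lemma dart_value_next:
  assumes F: "const_on_segments (range h) F" and x: "fst x < n"
  shows "dart_value F (next_dart n partner_of crossing_sign x) = dart_value F x"
proof -
  define k d where "k = dart_end n x" and "d = snd x"
  define j d' where "j = partner_of k" and "d' = (d = crossing_sign k)"
  have k: "k < n" using x by (auto simp: k_def dart_end_def cyc_less)
  have j: "j < n" "j \<noteq> k" "h (ts ! j) = h (ts ! k)" using partner_of[OF k] by (auto simp: j_def)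
  obtain e1 where e1: "e1 > 0" "\<And>u. 0 < u \<Longrightarrow> u < e1 \<Longrightarrow> simple_param (ts ! k + u) \<and> simple_param (ts ! k - u) \<and>
      (\<forall>F \<sigma>. const_on_segments (range h) (F :: complex \<Rightarrow> 'b) \<longrightarrow> \<bar>\<sigma>\<bar> = 1 \<longrightarrow>
      side F (ts ! k + u) \<sigma> = side F ((ts ! k + edge_end k) / 2) \<sigma> \<and>
      side F (ts ! k - u) \<sigma> = side F ((ts ! cyc_pred n k + edge_end (cyc_pred n k)) / 2) \<sigma>)"
    using near_position[OF k, where ?'b = 'b] by (elim exE conjE) simp
  obtain e2 where e2: "e2 > 0" "\<And>u. 0 < u \<Longrightarrow> u < e2 \<Longrightarrow> simple_param (ts ! j + u) \<and> simple_param (ts ! j - u) \<and>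
      (\<forall>F \<sigma>. const_on_segments (range h) (F :: complex \<Rightarrow> 'b) \<longrightarrow> \<bar>\<sigma>\<bar> = 1 \<longrightarrow>
      side F (ts ! j + u) \<sigma> = side F ((ts ! j + edge_end j) / 2) \<sigma> \<and>
      side F (ts ! j - u) \<sigma> = side F ((ts ! cyc_pred n j + edge_end (cyc_pred n j)) / 2) \<sigma>)"
    using near_position[OF j(1), where ?'b = 'b] by (elim exE conjE) simp
  have pos: "Im (cnj (dir d *\<^sub>R h' (ts ! k)) * (dir d' *\<^sub>R h' (ts ! j))) > 0"
    using transverse[OF j(3) T_diff_Ints[OF j(1) k j(2)]]
    by (auto simp: d'_def dir_def crossing_sign_def j_def)
  have "\<exists>\<delta>>0. \<forall>u u'. 0 < u \<longrightarrow> u < \<delta> \<longrightarrow> 0 < u' \<longrightarrow> u' < \<delta> \<longrightarrow>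
      side F (ts ! k - dir d * u) (dir d) = side F (ts ! j + dir d' * u') (dir d')"
  proof (rule side_corner[OF F j(3) T_diff_Ints[OF j(1) k j(2)] abs_dir abs_dir pos, of "min e1 e2"])
    show "min e1 e2 > 0" using e1 e2 by simp
    show "simple_param (ts ! k - dir d * u)" if "0 < u" "u < min e1 e2" for u
      using e1(2)[of u] that by (simp add: dir_def)
    show "simple_param (ts ! j + dir d' * u)" if "0 < u" "u < min e1 e2" for u
      using e2(2)[of u] that by (simp add: dir_def)
  qed
  then obtain \<delta> where \<delta>: "\<delta> > 0" "\<And>u u'. 0 < u \<Longrightarrow> u < \<delta> \<Longrightarrow> 0 < u' \<Longrightarrow> u' < \<delta> \<Longrightarrow>
      side F (ts ! k - dir d * u) (dir d) = side F (ts ! j + dir d' * u') (dir d')" by blast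
  define u where "u = min \<delta> (min e1 e2) / 2"
  have u: "0 < u" "u < \<delta>" "u < e1" "u < e2" using \<delta>(1) e1(1) e2(1) by (auto simp: u_def min_def)
  have ek: "cyc_pred n k = fst x" if d using that x by (simp add: k_def dart_end_def d_def cyc_inverse)
  have ek': "k = cyc_pred n (fst x)" if "\<not> d" using that by (simp add: k_def dart_end_def d_def)
  have "dart_value F x = side F (ts ! k - dir d * u) (dir d)"
  proof (cases d)
    case True
    then show ?thesis using e1(2)[OF u(1,3)] F ek by (simp add: dart_value_def Let_def d_def dir_def)
  next
    case False
    then show ?thesis using e1(2)[OF u(1,3)] F ek' by (simp add: dart_value_def Let_def d_def dir_def)
  qed
  also have "\<dots> = side F (ts ! j + dir d' * u) (dir d')" using \<delta>(2) u by blast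
  also have "\<dots> = dart_value F (j, d')"
    using e2(2)[OF u(1,4)] F by (cases d') (simp_all add: dart_value_def Let_def dir_def)
  also have "(j, d') = next_dart n partner_of crossing_sign x"
    by (simp add: next_dart_def j_def d'_def d_def k_def)
  finally show ?thesis by simp
qed

section \<open>Colours from the parity of winding numbers\<close>

definition first_position :: "'a \<Rightarrow> nat" where
  "first_position p = (SOME i. i < n \<and> i < partner_of i \<and> w ! i = p)"

lemma first_position:
  assumes "p \<in> set w"
  shows "first_position p < n" "first_position p < partner_of (first_position p)" "w ! first_position p = p"
proof -
  obtain k where k: "k < n" "w ! k = p" using assms by (metis in_set_conv_nth length_map)
  let ?j = "partner_of k"
  have j: "?j < n" "?j \<noteq> k" "w ! ?j = p" using partner_of[OF k(1)] w_nth_eq[of ?j k] k by auto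
  have "partner_of ?j = k" using same_point[OF j(1) k(1)] partner_of[OF k(1)] by auto
  then have "\<exists>i. i < n \<and> i < partner_of i \<and> w ! i = p" using k j by (metis linorder_neqE_nat)
  from someI_ex[OF this]
  show "first_position p < n" "first_position p < partner_of (first_position p)" "w ! first_position p = p"
    unfolding first_position_def by auto
qed

definition loop_winding :: "'a \<Rightarrow> complex \<Rightarrow> complex" where
  "loop_winding p = winding_number (subpath (ts ! first_position p) (ts ! partner_of (first_position p)) h)"

text \<open>At darts of the word the value is an integer embedded in the complex numbers, which
  \<open>Re\<close> and the floor recover.\<close>

definition colour :: "'a \<Rightarrow> nat \<times> bool \<Rightarrow> bool" where
  "colour p x = odd \<lfloor>Re (dart_value (loop_winding p) x)\<rfloor>"

lemma chord_loop: "p \<in> set w \<Longrightarrow> immersed_loop_chord h h' (ts ! first_position p) (ts ! partner_of (first_position p))"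
  using first_position[of p] partner_of[of "first_position p"] T_mono T_range
  by unfold_locales (auto simp: add.commute intro: less_le_trans[of _ 1])

text \<open>Edge \<open>k\<close> lies on the loop of \<open>p\<close> exactly when one occurrence
  of \<open>p\<close> has been passed; there the winding number jumps by 1. Otherwise none or both
  have been passed, and the two sides agree.\<close>

lemma colour_jump:
  assumes p: "p \<in> set w" and k: "k < n"
  shows "colour p (k, True) \<noteq> colour p (cyc_succ n k, False) \<longleftrightarrow> odd (card {m. m \<le> k \<and> w ! m = p})"
proof -
  define i j where "i = first_position p" and "j = partner_of i"
  have i: "i < n" "i < j" "w ! i = p" using first_position[OF p] by (auto simp: i_def j_def)
  have j: "j < n" using partner_of[OF i(1)] by (simp add: j_def)
  interpret C: immersed_loop_chord h h' "ts ! i" "ts ! j" using chord_loop[OF p] by (simp add: i_def j_def)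
  let ?W = "winding_number (subpath (ts ! i) (ts ! j) h)"
  have W: "loop_winding p = ?W" by (simp add: loop_winding_def i_def j_def)
  define t where "t = (ts ! k + edge_end k) / 2"
  have t: "ts ! k < t" "t < edge_end k" using edge_end_gt[OF k] by (auto simp: t_def)
  have simple: "simple_param t" by (rule simple_param_edge[OF k t])
  have col: "colour p (k, True) = odd \<lfloor>Re (side ?W t 1)\<rfloor>" "colour p (cyc_succ n k, False) = odd \<lfloor>Re (side ?W t (- 1))\<rfloor>"
    by (simp_all add: colour_def dart_value_def Let_def W dir_def t_def cyc_inverse k)
  have "{m. m \<le> k \<and> w ! m = p} = {m. m < n \<and> w ! m = w ! i} \<inter> {..k}" using k i by auto
  then have pos: "{m. m \<le> k \<and> w ! m = p} = {i, j} \<inter> {..k}" by (simp add: positions_w[OF i(1)] j_def)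
  show ?thesis
  proof (cases "i \<le> k \<and> k < j")
    case True
    then have "{i, j} \<inter> {..k} = {i}" by auto
    then have odd: "odd (card {m. m \<le> k \<and> w ! m = p})" by (simp add: pos)
    have "ts ! i \<le> ts ! k" using T_mono[of i k] True k by (cases "i = k") auto
    moreover have "edge_end k \<le> ts ! j" using T_mono[of "Suc k" j] True j by (cases "Suc k = j") (auto simp: edge_end_def)
    ultimately have d: "side ?W t 1 - side ?W t (- 1) = 1" using t by (intro C.side_W_inside simple) auto
    obtain a b where ab: "side ?W t 1 = of_int a" "side ?W t (- 1) = of_int b"
      using C.side_W_Ints[OF simple, of 1] C.side_W_Ints[OF simple, of "- 1"] by (auto elim!: Ints_cases)
    have "of_int (a - b) = (of_int 1 :: complex)" using d ab by simp
    then have "a - b = 1" by (simp only: of_int_eq_iff)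
    then have "odd a \<noteq> odd b" by presburger
    then show ?thesis using odd by (simp add: col ab)
  next
    case False
    then have "{i, j} \<inter> {..k} = (if k < i then {} else {i, j})" using i(2) by auto
    then have even: "even (card {m. m \<le> k \<and> w ! m = p})" using i(2) by (simp add: pos)
    have "s - t \<notin> \<int>" if s: "ts ! i \<le> s" "s \<le> ts ! j" for s
    proof -
      have "s \<noteq> t \<and> \<bar>s - t\<bar> < 1"
      proof (cases "k < i")
        case True
        then have "edge_end k \<le> ts ! i" using T_mono[of "Suc k" i] i(1) by (cases "Suc k = i") (auto simp: edge_end_def)
        then show ?thesis using s t T_range[OF k] T_range[OF j] by auto
      next
        case F: False
        then have "j \<le> k" using False by auto
        then have "ts ! j \<le> ts ! k" using T_mono[of j k] k by (cases "j = k") auto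
        moreover have "edge_end k \<le> ts ! i + 1"
          using T_mono[of 0 i] i(1) T_range[of "Suc k"] T_range[OF i(1)] k by (cases "i = 0") (auto simp: edge_end_def)
        ultimately show ?thesis using s t by auto
      qed
      then show ?thesis using Ints_nonzero_abs_ge1[of "s - t"] by auto
    qed
    then have "side ?W t 1 = side ?W t (- 1)" by (intro C.side_W_outside simple) auto
    then show ?thesis using even by (simp add: col)
  qed
qed

lemma coloured_word_w: "coloured_word w partner_of crossing_sign colour"
proof
  show "double_word w" by (rule double_word_w)
  show "w \<noteq> []" using nonempty_ts by simp
  show "partner_of k < length w \<and> partner_of k \<noteq> k \<and> w ! partner_of k = w ! k" if "k < length w" for k
    using that partner_of[of k] w_nth_eq[of "partner_of k" k] by simp
  show "colour p (next_dart (length w) partner_of crossing_sign x) = colour p x"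
    if "p \<in> set w" "fst x < length w" for p x
    using dart_value_next[OF immersed_loop_chord.const_on_segments_W[OF chord_loop[OF that(1)]], of x] that(2)
    by (simp add: colour_def loop_winding_def)
  show "colour p (k, True) \<noteq> colour p (cyc_succ (length w) k, False) \<longleftrightarrow> odd (card {m. m \<le> k \<and> w ! m = p})"
    if "p \<in> set w" "k < length w" for p k
    using colour_jump[OF that(1)] that(2) by simp
qed

lemma reduces_within_4_w: "reduces_within 4 w"
  using coloured_word.reduces_within_4[OF coloured_word_w] .

end

section \<open>Stereographic projection\<close>

definition stereo :: "real^3 \<Rightarrow> complex" where
  "stereo x = Complex (x $ 1 / (1 - x $ 3)) (x $ 2 / (1 - x $ 3))"

definition inv_stereo :: "complex \<Rightarrow> real^3" where
  "inv_stereo z = (1 / ((Re z)\<^sup>2 + (Im z)\<^sup>2 + 1)) *\<^sub>R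
     ((2 * Re z) *\<^sub>R axis 1 1 + (2 * Im z) *\<^sub>R axis 2 1 + ((Re z)\<^sup>2 + (Im z)\<^sup>2 - 1) *\<^sub>R axis 3 1)"

lemma inv_stereo_stereo:
  assumes "norm x = 1" "x $ 3 \<noteq> 1"
  shows "inv_stereo (stereo x) = x"
proof -
  define a b c where "a = x $ 1" and "b = x $ 2" and "c = x $ 3"
  have sq: "a\<^sup>2 + b\<^sup>2 = (1 - c) * (1 + c)"
    using assms(1) by (simp add: norm_eq_1 inner_vec_def sum_3 a_def b_def c_def power2_eq_square algebra_simps)
  have c: "1 - c \<noteq> 0" using assms(2) by (simp add: c_def)
  have "(a / (1 - c))\<^sup>2 + (b / (1 - c))\<^sup>2 = (a\<^sup>2 + b\<^sup>2) / (1 - c)\<^sup>2"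
    by (simp add: power_divide add_divide_distrib)
  also have "\<dots> = (1 + c) / (1 - c)" unfolding sq using c by (simp add: power2_eq_square)
  finally have r: "(a / (1 - c))\<^sup>2 + (b / (1 - c))\<^sup>2 = (1 + c) / (1 - c)" .
  have r1: "(1 + c) / (1 - c) + 1 = 2 / (1 - c)" "(1 + c) / (1 - c) - 1 = 2 * c / (1 - c)"
    using c by (simp_all add: field_simps)
  have e: "inv_stereo (stereo x) = ((1 - c) / 2) *\<^sub>R
      ((2 * (a / (1 - c))) *\<^sub>R axis 1 1 + (2 * (b / (1 - c))) *\<^sub>R axis 2 1 + (2 * c / (1 - c)) *\<^sub>R axis 3 1)"
    unfolding inv_stereo_def stereo_def by (simp add: a_def[symmetric] b_def[symmetric] c_def[symmetric] r r1)
  have "inv_stereo (stereo x) $ i = x $ i" for i :: 3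
    using exhaust_3[of i] c unfolding e by (auto simp: axis_def a_def b_def c_def)
  then show ?thesis by (simp add: vec_eq_iff)
qed

lemma differentiable_inv_stereo: "inv_stereo differentiable at z"
proof -
  have p: "(Re z)\<^sup>2 + (Im z)\<^sup>2 + 1 \<noteq> 0" by (smt (verit) zero_le_power2)
  have [derivative_intros]: "Re differentiable at z" "Im differentiable at z"
    by (auto intro: bounded_linear_imp_differentiable bounded_linear_Re bounded_linear_Im)
  show ?thesis
    unfolding inv_stereo_def
    by (intro differentiable_scaleR differentiable_add differentiable_diff differentiable_divide differentiable_mult
        differentiable_power differentiable_const derivative_intros p)
qed

text \<open>The cone over the curve is a differentiable image of a plane, hence negligible in
  \<open>real^3\<close>. A vector off this cone, normalised, is off the curve.\<close>

lemma sphere_curve_misses_point: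
  fixes g :: "real \<Rightarrow> real^3"
  assumes "\<And>t. g differentiable at t"
  obtains x where "norm x = 1" "x \<notin> range g"
proof -
  let ?G = "\<lambda>p::real \<times> real. fst p *\<^sub>R g (snd p)"
  have "?G differentiable_on UNIV"
    unfolding differentiable_on_def
  proof
    fix p :: "real \<times> real"
    have "(g \<circ> snd) differentiable at p"
      by (rule differentiable_chain_at[OF bounded_linear_imp_differentiable[OF bounded_linear_snd] assms])
    then have "(\<lambda>p. g (snd p)) differentiable at p" by (simp add: o_def)
    then show "?G differentiable at p"
      by (rule differentiable_scaleR[OF bounded_linear_imp_differentiable[OF bounded_linear_fst]])
  qed
  then have "negligible (range ?G)" by (rule negligible_differentiable_image_lowdim[rotated]) simp
  then have "range ?G \<noteq> UNIV" using non_negligible_UNIV by metis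
  then obtain y where y: "y \<notin> range ?G" by blast
  have "y \<noteq> 0"
  proof
    assume "y = 0"
    then have "y = ?G (0, 0)" by simp
    then show False using y by blast
  qed
  have "y /\<^sub>R norm y \<notin> range g"
  proof
    assume "y /\<^sub>R norm y \<in> range g"
    then obtain t where "g t = y /\<^sub>R norm y" by auto
    then have "y = ?G (norm y, t)" using \<open>y \<noteq> 0\<close> by simp
    then show False using y by blast
  qed
  then show ?thesis using that[of "y /\<^sub>R norm y"] \<open>y \<noteq> 0\<close> by simp
qed

text \<open>Rotate a missed point to the north pole and project from it. Immersion and
  transversality are transferred through the differentiable left inverse \<open>\<Psi>\<close>: the
  chain rule makes \<open>g' t\<close> a linear image of \<open>h' t\<close>, so a zero tangent, or
  two dependent tangents at a crossing, in the plane would give the same on the sphere.\<close>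

lemma spherical_curve_projection:
  fixes g :: "real \<Rightarrow> real^3"
  assumes g: "spherical_curve g"
  obtains h h' where "immersed_loop h h'" "\<forall>s t. h s = h t \<longleftrightarrow> g s = g t"
proof -
  define g' where "g' = (\<lambda>t. vector_derivative g (at t))"
  have per: "\<And>t. g (t + 1) = g t" and sph: "\<And>t. norm (g t) = 1" and smooth: "smooth_curve g"
    and nz: "\<And>t. g' t \<noteq> 0"
    and triple: "\<And>t s u. t \<in> {0..<1} \<Longrightarrow> s \<in> {0..<1} \<Longrightarrow> u \<in> {0..<1} \<Longrightarrow>
        t \<noteq> s \<Longrightarrow> s \<noteq> u \<Longrightarrow> t \<noteq> u \<Longrightarrow> \<not> (g t = g s \<and> g s = g u)"
    and trans: "\<And>t s c. t \<in> {0..<1} \<Longrightarrow> s \<in> {0..<1} \<Longrightarrow> t \<noteq> s \<Longrightarrow> g t = g s \<Longrightarrow> g' s \<noteq> c *\<^sub>R g' t"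
    using g unfolding spherical_curve_def g'_def by auto
  have diff: "g differentiable at t" for t
    using smooth[unfolded smooth_curve_def, rule_format, of 0 t] by (simp add: iter_vderiv_def)
  have "g' differentiable at t" for t
    using smooth[unfolded smooth_curve_def, rule_format, of 1 t] by (simp add: iter_vderiv_def g'_def)
  then have cont: "continuous_on UNIV g'"
    by (simp add: continuous_at_imp_continuous_on differentiable_imp_continuous_within)
  have der: "(g has_vector_derivative g' t) (at t)" for t
    using diff by (simp add: g'_def vector_derivative_works)
  have per': "g' (t + 1) = g' t" for t unfolding g'_def by (rule vector_derivative_periodic[OF per diff])
  obtain N where N: "norm N = 1" "N \<notin> range g" by (rule sphere_curve_misses_point[OF diff])
  obtain f where f: "orthogonal_transformation f" "f N = (axis 3 1 :: real^3)"
    by (rule orthogonal_transformation_exists_1[OF N(1), of "axis 3 1"]) auto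
  have lin: "bounded_linear f"
    using orthogonal_transformation_linear[OF f(1)] linear_conv_bounded_linear by blast
  have inj: "inj f" using f(1) by (rule orthogonal_transformation_inj)
  have lin': "bounded_linear (inv f)"
    using orthogonal_transformation_linear[OF orthogonal_transformation_inv[OF f(1)]] linear_conv_bounded_linear by blast
  define G G' where "G = (\<lambda>t. f (g t))" and "G' = (\<lambda>t. f (g' t))"
  have derG: "(G has_vector_derivative G' t) (at t)" for t
    unfolding G_def G'_def by (rule bounded_linear.has_vector_derivative[OF lin der])
  have contG: "continuous_on UNIV G'"
    unfolding G'_def by (rule bounded_linear.continuous_on[OF lin cont])
  have contG0: "continuous_on UNIV G"
    by (simp add: continuous_at_imp_continuous_on has_vector_derivative_continuous[OF derG])
  have normG: "norm (G t) = 1" for t using f(1) sph by (simp add: G_def orthogonal_transformation_norm)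
  have G3: "G t $ 3 \<noteq> 1" for t
  proof
    assume one: "G t $ 3 = 1"
    have "(G t $ 1)\<^sup>2 + (G t $ 2)\<^sup>2 + (G t $ 3)\<^sup>2 = 1"
      using normG[of t] by (simp add: norm_eq_1 inner_vec_def sum_3 power2_eq_square)
    then have "G t $ 1 = 0" "G t $ 2 = 0" using one by (auto simp: sum_power2_eq_zero_iff)
    then have "G t = axis 3 1" using one by (simp add: vec_eq_iff forall_3 axis_def)
    then have "g t = N" using f(2) inj by (metis G_def injD)
    then show False using N(2) by blast
  qed
  define h where "h = (\<lambda>t. stereo (G t))"
  define D where "D = (\<lambda>t i. (G' t $ i * (1 - G t $ 3) + G t $ i * G' t $ 3) / (1 - G t $ 3)\<^sup>2)"
  define h' where "h' = (\<lambda>t. Complex (D t 1) (D t 2))"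
  have comp: "((\<lambda>t. G t $ i) has_field_derivative G' t $ i) (at t)" for t i
    unfolding has_real_derivative_iff_has_vector_derivative
    by (rule bounded_linear.has_vector_derivative[OF bounded_linear_vec_nth derG])
  have quot: "((\<lambda>t. G t $ i / (1 - G t $ 3)) has_field_derivative D t i) (at t)" for t i
    using G3[of t] unfolding D_def
    by (auto intro!: derivative_eq_intros comp simp: power2_eq_square)
  have derh: "(h has_vector_derivative h' t) (at t)" for t
    unfolding has_vector_derivative_complex_iff h_def h'_def stereo_def using quot by simp
  have conth: "continuous_on UNIV h'"
    unfolding h'_def D_def using contG contG0 G3 by (intro continuous_intros) auto
  define \<Psi> where "\<Psi> = (\<lambda>z. inv f (inv_stereo z))"
  have \<Psi>: "\<Psi> (h t) = g t" for t
    using inv_stereo_stereo[OF normG G3] inj by (simp add: \<Psi>_def h_def G_def)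
  have heq: "h s = h t \<longleftrightarrow> g s = g t" for s t using \<Psi> by (metis G_def h_def)
  have "\<Psi> differentiable at z" for z
    unfolding \<Psi>_def using differentiable_chain_at[OF differentiable_inv_stereo bounded_linear_imp_differentiable[OF lin']]
    by (simp add: o_def)
  then obtain L where L: "(\<Psi> has_derivative L z) (at z)" for z unfolding differentiable_def by metis
  have gL: "g' t = L (h t) (h' t)" for t
  proof -
    have "((\<Psi> \<circ> h) has_derivative (L (h t) \<circ> (\<lambda>x. x *\<^sub>R h' t))) (at t)"
      using diff_chain_at[OF derh[of t, unfolded has_vector_derivative_def] L] .
    moreover have "L (h t) \<circ> (\<lambda>x. x *\<^sub>R h' t) = (\<lambda>x. x *\<^sub>R L (h t) (h' t))"
      using linear_scale[OF has_derivative_linear[OF L]] by auto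
    moreover have "\<Psi> \<circ> h = g" using \<Psi> by auto
    ultimately have "(g has_vector_derivative L (h t) (h' t)) (at t)" by (simp add: has_vector_derivative_def)
    then show ?thesis using der vector_derivative_unique_at by blast
  qed
  have frac01: "frac x \<in> {0..<1::real}" for x by (simp add: frac_ge_0 frac_lt_1)
  have gfrac: "g (frac t) = g t" "g' (frac t) = g' t" for t
    by (rule frac_of_periodic, rule per, rule frac_of_periodic, rule per')
  have "immersed_loop h h'"
  proof
    show "h (t + 1) = h t" for t by (simp add: h_def G_def per)
    show "(h has_vector_derivative h' t) (at t)" for t by (rule derh)
    show "continuous_on UNIV h'" by (rule conth)
    show hnz: "h' t \<noteq> 0" for t
      using gL[of t] nz[of t] linear_0[OF has_derivative_linear[OF L]] by auto
    show "Im (cnj (h' t) * h' s) \<noteq> 0" if st: "h s = h t" "s - t \<notin> \<int>" for s t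
    proof
      assume "Im (cnj (h' t) * h' s) = 0"
      define c where "c = Re (h' s / h' t)"
      have "Im (h' s / h' t) = 0"
        using \<open>Im (cnj (h' t) * h' s) = 0\<close> by (simp add: Im_divide algebra_simps)
      then have "h' s / h' t = of_real c" by (simp add: c_def complex_eq_iff)
      then have "h' s = c *\<^sub>R h' t" using hnz[of t] by (simp add: scaleR_conv_of_real field_simps)
      then have "g' s = c *\<^sub>R g' t"
        using gL[of s] gL[of t] st(1) linear_scale[OF has_derivative_linear[OF L]] by simp
      then show False
        using trans[OF frac01[of t] frac01[of s], of c] gfrac st heq[of s t] frac_eq_iff[of s t] by auto
    qed
    show "s - u \<in> \<int>" if "h s = h t" "h u = h t" "s - t \<notin> \<int>" "u - t \<notin> \<int>" for s t u
      using triple[OF frac01[of s] frac01[of t] frac01[of u]] that heq gfrac frac_eq_iff by metis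
  qed
  then show ?thesis using that heq by blast
qed

theorem theorem1:
  fixes g :: "real \<Rightarrow> real^3"
  assumes "spherical_curve g"
  shows "\<exists>k \<le> 4. \<exists>v. (splice_step ^^ k) (gauss_word g) v \<and> reducible_word v"
proof -
  obtain h h' where loop: "immersed_loop h h'" and heq: "\<forall>s t. h s = h t \<longleftrightarrow> g s = g t"
    by (rule spherical_curve_projection[OF assms]) 
  have fin: "finite (double_params g)" "double_params g \<noteq> {}" using assms by (auto simp: spherical_curve_def)
  have "gauss_loop h h' (sorted_list_of_set (double_params g)) g"
  proof (rule gauss_loop.intro[OF loop], unfold_locales)
    show "sorted_wrt (<) (sorted_list_of_set (double_params g))" by simp
    show "sorted_list_of_set (double_params g) \<noteq> []" using fin by simp
    show "set (sorted_list_of_set (double_params g)) = {t \<in> {0..<1}. \<exists>s\<in>{0..<1}. s \<noteq> t \<and> h s = h t}"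
      using fin by (simp add: double_params_def heq)
  qed (simp add: heq)
  then have "reduces_within 4 (gauss_word g)" unfolding gauss_word_def by (rule gauss_loop.reduces_within_4_w)
  then show ?thesis unfolding reduces_within_def .
qed

end
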